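(* Let $n\ge2$, $r\ge2$ and let $\lambda\in P_r$ be dominant, i.e. $\lambda_1\ge\cdots\ge\lambda_r$. Write $\lambda=\lambda^{(0)}+n\lambda^{(1)}$ with $\lambda^{(0)},\lambda^{(1)}\in P_r$, where $\lambda^{(0)}$ is $n$-restricted, that is, $$0\le\lambda^{(0)}_i-\lambda^{(0)}_{i+1}<n\qquad(1\le i\le r-1),$$ and $\lambda^{(1)}_r\ge0$. Then, in $\mathcal F_r$, $$G^-_{\lambda+\rho}=S_{\lambda^{(1)}}\,G^-_{\lambda^{(0)}+\rho}.$$
   Context: Let $P_r=\mathbb Z^r$ with standard basis $\epsilon_1,\ldots,\epsilon_r$, $P_r^{++}=\{\lambda\in P_r:\lambda_1>\cdots>\lambda_r\}$, $\rho=(r-1,r-2,\ldots,1,0)$. **The module $\mathcal F_r$.** $\mathcal F_r$ is the $\mathbb Z[q,q^{-1}]$-module generated by symbols $|\lambda\rangle$ ($\lambda\in P_r$) subject to the following relations. First, $|\lambda\rangle=0$ if $\lambda_i=\lambda_{i+1}$ for some $i$. Second, for $\mu\in P_r$ and $i$ with $\mu_i<\mu_{i+1}$, write $\mu_{i+1}=\mu_i+kn+j$ with $k\ge0$, $0\le j<n$, and let $|a,b\rangle$ denote the vector whose $i$-th and $(i+1)$-th components are $a,b$ and whose other components are those of $\mu$; then $|\mu\rangle=-|\mu_{i+1},\mu_i\rangle$ if $j=0$; $|\mu\rangle=-q^{-1}|\mu_{i+1},\mu_i\rangle$ if $k=0$; and otherwise $|\mu\rangle=-q^{-1}|\mu_{i+1},\mu_i\rangle-|\mu_i+kn,\mu_{i+1}-kn\rangle-q^{-1}|\mu_{i+1}-kn,\mu_i+kn\rangle$.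 The vectors $|\lambda\rangle$ with $\lambda\in P_r^{++}$ form a basis of $\mathcal F_r$. (Equivalently, $\mathcal F_r$ is the quotient of the affine Hecke algebra module on the weight lattice, with action at parameter $m=-n$, by the sum of the images of $T_i+q$, $1\le i\le r-1$.) **Bar involution.** It is the semi-linear ($\overline{qv}=q^{-1}\overline v$, additive) involution of $\mathcal F_r$ given, for all $\lambda\in P_r$, by $\overline{|\lambda\rangle}=(-1)^{r(r-1)/2}q^{N(\lambda)}\,|\lambda_r,\ldots,\lambda_1\rangle$, where $N(\lambda)$ is the number of pairs $i<j$ such that $\lambda_i-\lambda_j$ is not divisible by $n$. **Canonical basis.** Let $\mathcal L^-$ be the $\mathbb Z[q^{-1}]$-span of $\{|\lambda\rangle:\lambda\in P_r^{++}\}$. $\{G^-_\lambda:\lambda\in P_r^{++}\}$ is the basis of $\mathcal F_r$ characterized by $\overline{G^-_\lambda}=G^-_\lambda$ and $G^-_\lambda\equiv|\lambda\rangle\bmod q^{-1}\mathcal L^-$. **Action of the center.** Symmetric Laurent polynomials in the commuting Bernstein generators $Y_1,\ldots,Y_r$ act on $\mathcal F_r$: $f=\sum_\beta f_\beta Y^\beta$ acts by $f\,|\lambda\rangle=\sum_\beta f_\beta\,|\lambda-n\beta\rangle$ for all $\lambda\in P_r$ (this is well defined). For a partition $\kappa$ of length $\le r$, $S_\kappa:=s_\kappa(Y_1^{-1},\ldots,Y_r^{-1})$, where $s_\kappa$ is the Schur polynomial; thus $S_\kappa|\lambda\rangle=\sum_\beta s_{\kappa,\beta}|\lambda+n\beta\rangle$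 where $s_{\kappa,\beta}$ is the coefficient of $x^\beta$ in $s_\kappa(x_1,\ldots,x_r)$. *)

theory Defs
  imports
    Complex_Main
    "HOL-Library.Cardinality"
    "HOL-Library.Poly_Mapping"
    "HOL-Combinatorics.Permutations"
begin

section \<open>Scalars\<close>

text \<open>
  The ring of integral Laurent polynomials in q is the group ring of the integers
  (the product of \<^typ>\<open>int \<Rightarrow>\<^sub>0 int\<close> is convolution).
\<close>

type_synonym laurent = "int \<Rightarrow>\<^sub>0 int"

definition qpow :: "int \<Rightarrow> laurent" where
  "qpow k = Poly_Mapping.single k 1"

definition laurent_conj :: "laurent \<Rightarrow> laurent" where
  "laurent_conj c = Poly_Mapping.map_key uminus c"

definition poly_in_qinv :: "laurent set" where
  "poly_in_qinv = {c. Poly_Mapping.keys c \<subseteq> {..0}}"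


section \<open>Weights\<close>

text \<open>
  A weight of rank r is an integer list of length r; list positions are counted from 0.
\<close>

definition strict_weights :: "nat \<Rightarrow> int list set" where
  "strict_weights r = {\<mu>. length \<mu> = r \<and> sorted_wrt (>) \<mu>}"

definition weight_add :: "int list \<Rightarrow> int list \<Rightarrow> int list" where
  "weight_add \<mu> \<nu> = map2 (+) \<mu> \<nu>"

definition weight_scale :: "int \<Rightarrow> int list \<Rightarrow> int list" where
  "weight_scale c \<mu> = map ((*) c) \<mu>"

definition rho :: "nat \<Rightarrow> int list" where
  "rho r = map (\<lambda>i. int (r - 1 - i)) [0..<r]"


section \<open>The modules \<open>\<F>\<^sub>r\<close>\<close>

type_synonym prefock = "int list \<Rightarrow>\<^sub>0 laurent"

definition prescale :: "laurent \<Rightarrow> prefock \<Rightarrow> prefock" where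
  "prescale c v = Poly_Mapping.map ((*) c) v"

definition preket :: "int list \<Rightarrow> prefock" where
  "preket \<mu> = Poly_Mapping.single \<mu> 1"

lemma lookup_prescale:
  "Poly_Mapping.lookup (prescale c v) \<mu> = c * Poly_Mapping.lookup v \<mu>"
  by (simp add: prescale_def Poly_Mapping.map.rep_eq when_def)

interpretation prefock: module prescale
  by unfold_locales
    (auto intro!: poly_mapping_eqI simp: lookup_prescale lookup_add algebra_simps)

text \<open>
  The defining relations, in the form ``left-hand side minus right-hand side''; the entries
  a and b occupy an arbitrary pair of adjacent positions.
\<close>

inductive_set relators :: "nat \<Rightarrow> prefock set" for n :: nat where
  equal: "preket (xs @ [a, a] @ ys) \<in> relators n"
| j_zero:
    "\<lbrakk>a < b; b = a + k * int n\<rbrakk> \<Longrightarrow>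
     preket (xs @ [a, b] @ ys) + preket (xs @ [b, a] @ ys) \<in> relators n"
| k_zero:
    "\<lbrakk>a < b; b = a + j; j < int n\<rbrakk> \<Longrightarrow>
     preket (xs @ [a, b] @ ys) + prescale (qpow (- 1)) (preket (xs @ [b, a] @ ys)) \<in> relators n"
| generic:
    "\<lbrakk>b = a + k * int n + j; 0 < k; 0 < j; j < int n\<rbrakk> \<Longrightarrow>
     preket (xs @ [a, b] @ ys)
     + prescale (qpow (- 1)) (preket (xs @ [b, a] @ ys))
     + preket (xs @ [a + k * int n, b - k * int n] @ ys)
     + prescale (qpow (- 1)) (preket (xs @ [b - k * int n, a + k * int n] @ ys)) \<in> relators n"

definition fock_rel :: "'n itself \<Rightarrow> prefock \<Rightarrow> prefock \<Rightarrow> bool" where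
  "fock_rel _ u v \<longleftrightarrow> u - v \<in> prefock.span (relators CARD('n))"

lemma equivp_fock_rel: "equivp (fock_rel TYPE('n))"
proof (rule equivpI)
  show "reflp (fock_rel TYPE('n))"
    by (simp add: reflp_def fock_rel_def prefock.span_zero)
  show "symp (fock_rel TYPE('n))"
  proof (rule sympI)
    fix u v assume "fock_rel TYPE('n) u v"
    from prefock.span_neg[OF this[unfolded fock_rel_def]] show "fock_rel TYPE('n) v u"
      by (simp add: fock_rel_def)
  qed
  show "transp (fock_rel TYPE('n))"
  proof (rule transpI)
    fix u v w assume "fock_rel TYPE('n) u v" "fock_rel TYPE('n) v w"
    from prefock.span_add[OF this[unfolded fock_rel_def]] show "fock_rel TYPE('n) u w"
      by (simp add: fock_rel_def)
  qed
qed

text \<open>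
  The relations preserve the length of weights, so the quotient below is the direct sum of the
  modules \<open>\<F>\<^sub>r\<close> for all r, with \<open>\<F>\<^sub>r\<close> the span of the vectors of rank r (\<open>fock_space\<close> below).
  The modulus n is the cardinality of the index type.
\<close>

quotient_type 'n fock = prefock / "fock_rel TYPE('n)"
  by (rule equivp_fock_rel)

instantiation fock :: (type) ab_group_add
begin

lift_definition zero_fock :: "'a fock" is 0 .

lift_definition plus_fock :: "'a fock \<Rightarrow> 'a fock \<Rightarrow> 'a fock" is "(+)"
proof -
  fix u u' v v' assume "fock_rel TYPE('a) u u'" "fock_rel TYPE('a) v v'"
  from prefock.span_add[OF this[unfolded fock_rel_def]]
  show "fock_rel TYPE('a) (u + v) (u' + v')"
    by (simp add: fock_rel_def add_diff_add)
qed

lift_definition uminus_fock :: "'a fock \<Rightarrow> 'a fock" is uminus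
proof -
  fix u u' assume "fock_rel TYPE('a) u u'"
  from prefock.span_neg[OF this[unfolded fock_rel_def]]
  show "fock_rel TYPE('a) (- u) (- u')"
    by (simp add: fock_rel_def)
qed

definition minus_fock :: "'a fock \<Rightarrow> 'a fock \<Rightarrow> 'a fock" where
  "minus_fock x y = x + - y"

instance
proof
  fix x y z :: "'a fock"
  have refl: "fock_rel TYPE('a) u u" for u
    by (simp add: fock_rel_def prefock.span_zero)
  show "x + y + z = x + (y + z)" by transfer (simp add: add.assoc refl)
  show "x + y = y + x" by transfer (simp add: add.commute refl)
  show "0 + x = x" by transfer (simp add: refl)
  show "- x + x = 0" by transfer (simp add: refl)
  show "x - y = x + - y" by (rule minus_fock_def)
qed

end

lift_definition scale :: "laurent \<Rightarrow> 'n fock \<Rightarrow> 'n fock" is prescale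
proof -
  fix c u u' assume "fock_rel TYPE('n) u u'"
  from prefock.span_scale[OF this[unfolded fock_rel_def], of c]
  show "fock_rel TYPE('n) (prescale c u) (prescale c u')"
    by (simp add: fock_rel_def prefock.scale_right_diff_distrib)
qed

lift_definition ket :: "int list \<Rightarrow> 'n fock" is preket .

interpretation fock: module "scale :: laurent \<Rightarrow> 'n fock \<Rightarrow> 'n fock"
proof
  fix a b :: laurent and x y :: "'n fock"
  have refl: "fock_rel TYPE('n) u u" for u
    by (simp add: fock_rel_def prefock.span_zero)
  show "scale a (x + y) = scale a x + scale a y"
    by transfer (simp add: prefock.scale_right_distrib refl)
  show "scale (a + b) x = scale a x + scale b x"
    by transfer (simp add: prefock.scale_left_distrib refl)
  show "scale a (scale b x) = scale (a * b) x"
    by transfer (simp add: refl)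
  show "scale 1 x = x"
    by transfer (simp add: refl)
qed

definition fock_space :: "nat \<Rightarrow> 'n fock set" where
  "fock_space r = fock.span (ket ` {\<mu>. length \<mu> = r})"


section \<open>Bar involution\<close>

definition noncong_pairs :: "nat \<Rightarrow> int list \<Rightarrow> nat" where
  "noncong_pairs n \<mu> =
     card {(i, j). i < j \<and> j < length \<mu> \<and> \<not> int n dvd \<mu> ! i - \<mu> ! j}"

definition prebar :: "nat \<Rightarrow> prefock \<Rightarrow> prefock" where
  "prebar n v = (\<Sum>\<mu>\<in>Poly_Mapping.keys v.
     prescale (laurent_conj (Poly_Mapping.lookup v \<mu>)
               * (- 1) ^ (length \<mu> * (length \<mu> - 1) div 2) * qpow (int (noncong_pairs n \<mu>)))
       (preket (rev \<mu>)))"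

text \<open>
  \<^const>\<open>prebar\<close> preserves the submodule of relations, so \<open>bar\<close> does not depend on the
  representative.
\<close>

definition bar :: "'n fock \<Rightarrow> 'n fock" where
  "bar x = abs_fock (prebar CARD('n) (rep_fock x))"


section \<open>Canonical basis\<close>

definition lattice_minus :: "nat \<Rightarrow> 'n fock set" where
  "lattice_minus r = {(\<Sum>\<mu>\<in>A. scale (c \<mu>) (ket \<mu>)) | A c.
     finite A \<and> A \<subseteq> strict_weights r \<and> (\<forall>\<mu>\<in>A. c \<mu> \<in> poly_in_qinv)}"

definition is_canonical_basis :: "nat \<Rightarrow> (int list \<Rightarrow> 'n fock) \<Rightarrow> bool" where
  "is_canonical_basis r G \<longleftrightarrow>
     inj_on G (strict_weights r) \<and>
     fock.independent (G ` strict_weights r) \<and>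
     fock.span (G ` strict_weights r) = fock_space r \<and>
     (\<forall>\<mu>\<in>strict_weights r.
        bar (G \<mu>) = G \<mu> \<and>
        G \<mu> - ket \<mu> \<in> scale (qpow (- 1)) ` lattice_minus r)"


section \<open>Action of symmetric Laurent polynomials\<close>

text \<open>
  Integral Laurent polynomials in variables \<open>x\<^sub>i\<close>, i a natural number (from 0). In rank r only the
  variables with index below r occur.
\<close>

type_synonym mlaurent = "(nat \<Rightarrow>\<^sub>0 int) \<Rightarrow>\<^sub>0 int"

definition precenter_act :: "nat \<Rightarrow> nat \<Rightarrow> mlaurent \<Rightarrow> prefock \<Rightarrow> prefock" where
  "precenter_act n r f v = (\<Sum>\<mu>\<in>{\<mu> \<in> Poly_Mapping.keys v. length \<mu> = r}. \<Sum>\<beta>\<in>Poly_Mapping.keys f.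
     prescale (of_int (Poly_Mapping.lookup f \<beta>) * Poly_Mapping.lookup v \<mu>)
       (preket (map (\<lambda>i. \<mu> ! i - int n * Poly_Mapping.lookup \<beta> i) [0..<r])))"

text \<open>
  The action of \<open>f(Y\<^sub>1, \<dots>, Y\<^sub>r)\<close> on \<open>\<F>\<^sub>r\<close>, with \<open>x\<^sub>i\<close> standing for the (i+1)-st generator; the
  components of other ranks are sent to 0. It is used only for f symmetric in the first r
  variables, for which \<^const>\<open>precenter_act\<close> preserves the submodule of relations and the result
  does not depend on the representative.
\<close>

definition center_act :: "nat \<Rightarrow> mlaurent \<Rightarrow> 'n fock \<Rightarrow> 'n fock" where
  "center_act r f x = abs_fock (precenter_act CARD('n) r f (rep_fock x))"

definition alternant :: "nat \<Rightarrow> int list \<Rightarrow> mlaurent" where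
  "alternant r \<alpha> = (\<Sum>\<pi> | \<pi> permutes {..<r}.
     of_int (sign \<pi>) * Poly_Mapping.single (\<Sum>i<r. Poly_Mapping.single i (\<alpha> ! \<pi> i)) 1)"

text \<open>
  The Schur polynomial of a partition \<open>\<kappa>\<close>, written as a list of length r padded with zeros, is the
  quotient of alternants.
\<close>

definition schur :: "nat \<Rightarrow> int list \<Rightarrow> mlaurent" where
  "schur r \<kappa> = (THE s. s * alternant r (rho r) = alternant r (weight_add \<kappa> (rho r)))"

definition invert_vars :: "mlaurent \<Rightarrow> mlaurent" where
  "invert_vars f = Poly_Mapping.map_key uminus f"

definition S_op :: "nat \<Rightarrow> int list \<Rightarrow> 'n fock \<Rightarrow> 'n fock" where
  "S_op r \<kappa> = center_act r (invert_vars (schur r \<kappa>))"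

end

theory Submission
  imports Defs "Jordan_Normal_Form.Determinant"
begin

text \<open>
  Write \<open>t\<close> for the inverse of \<open>q\<close>, \<open>L\<close> for the lattice spanned over the polynomials in \<open>t\<close> by the
  strict kets, and \<open>S\<close> for the action of the Schur polynomial of the partition \<open>lam1\<close>. The vector
  \<open>S G\<close>, with \<open>G\<close> the canonical basis vector at \<open>lam0 + \<rho>\<close>, is bar-invariant, because bar commutes
  with symmetric Laurent polynomials. It therefore equals the canonical basis vector at
  \<open>lam + \<rho>\<close> as soon as the two agree modulo \<open>t L\<close>.

  Straightening a ket only produces coefficients that are polynomials in \<open>t\<close>, so every ket of rank
  \<open>r\<close>, strict or not, lies in \<open>L\<close> (\<open>ket_in_lattice\<close>). Consequently \<open>S\<close> preserves \<open>L\<close>, and only the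
  ket of \<open>\<mu> = lam0 + \<rho>\<close> matters modulo \<open>t L\<close>. The gaps of \<open>\<mu>\<close> lie between 1 and \<open>n\<close>, and
  this makes the kets of \<open>\<mu> + n (\<gamma> - \<rho>)\<close> antisymmetric in \<open>\<gamma>\<close> modulo \<open>t L\<close>
  (\<open>ket_adjacent_antisymmetric\<close>). An antisymmetric functional takes the same value on \<open>s x\<^sup>\<rho>\<close> as on
  \<open>x\<^sup>\<kappa>\<^sup>+\<^sup>\<rho>\<close> when \<open>s\<close> is the Schur polynomial of \<open>\<kappa>\<close>. Indeed, the product of \<open>s\<close> with the
  alternant of \<open>\<rho>\<close> is the alternant of \<open>\<kappa> + \<rho>\<close>, and the value of the functional on the one as well
  as on the other is \<open>r!\<close> times the value in question (\<open>antisymmetrization\<close>); the factor \<open>r!\<close> can be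
  cancelled at the end. For \<open>\<kappa> = lam1\<close>, the two values are \<open>S\<close> applied to the ket of \<open>\<mu>\<close>, and
  the ket of \<open>\<mu> + n lam1 = lam + \<rho>\<close>.

  The uniqueness used above, that a bar-invariant vector in \<open>t L\<close> vanishes
  (\<open>bar_invariant_in_qinv_lattice\<close>), follows by expanding the vector in the given canonical basis and
  looking at the highest power of \<open>q\<close> among the coefficients, provided that the strict kets are
  linearly independent. For the independence (\<open>strict_kets_independent\<close>), observe that the
  relations become those of an exterior power at \<open>q = 1\<close>; hence all coefficients of a linear relation
  between strict kets are divisible by \<open>1 - t\<close>. The Fock space is free on the canonical basis, so that
  this factor can be cancelled, and infinite descent shows that the relation is trivial.
\<close>

section \<open>Additive maps on finitely supported functions\<close>

text \<open>
  The maps on the coefficients are meant to be additive only, so that conjugation is covered.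
\<close>

definition extend :: "('k \<Rightarrow> 'a::zero \<Rightarrow> 'b::comm_monoid_add) \<Rightarrow> ('k \<Rightarrow>\<^sub>0 'a) \<Rightarrow> 'b" where
  "extend F v = (\<Sum>k\<in>Poly_Mapping.keys v. F k (Poly_Mapping.lookup v k))"

lemma additive_extend:
  fixes F :: "'k \<Rightarrow> 'a::ab_group_add \<Rightarrow> 'b::ab_group_add"
  assumes "\<And>k. additive (F k)"
  shows "additive (extend F)"
  unfolding extend_def
  by (rule additive.intro, rule setsum_keys_plus_distrib)
    (use assms in \<open>auto simp: additive.zero additive.add\<close>)

lemma extend_single:
  assumes "F k 0 = 0"
  shows "extend F (Poly_Mapping.single k c) = F k c"
  using assms by (simp add: extend_def)

lemma sum_singles: "(\<Sum>k\<in>Poly_Mapping.keys v. Poly_Mapping.single k (Poly_Mapping.lookup v k)) = v"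
  by (rule poly_mapping_eqI)
    (simp add: lookup_sum lookup_single when_def if_distrib in_keys_iff cong: if_cong)

lemma additive_eq_on_singles:
  fixes f g :: "('k \<Rightarrow>\<^sub>0 'a::ab_group_add) \<Rightarrow> 'b::ab_group_add"
  assumes f: "additive f" and g: "additive g"
    and "\<And>k c. f (Poly_Mapping.single k c) = g (Poly_Mapping.single k c)"
  shows "f v = g v"
proof -
  have "f (\<Sum>k\<in>Poly_Mapping.keys v. Poly_Mapping.single k (Poly_Mapping.lookup v k))
      = g (\<Sum>k\<in>Poly_Mapping.keys v. Poly_Mapping.single k (Poly_Mapping.lookup v k))"
    by (simp only: additive.sum[OF f] additive.sum[OF g] assms(3))
  then show ?thesis by (simp only: sum_singles)
qed

lemma mult_eq_on_singles:
  fixes h :: "('k::comm_monoid_add \<Rightarrow>\<^sub>0 'a::comm_ring_1) \<Rightarrow> ('l::comm_monoid_add \<Rightarrow>\<^sub>0 'a)"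
  assumes h: "additive h"
    and s: "\<And>k c l d. h (Poly_Mapping.single k c * Poly_Mapping.single l d)
        = h (Poly_Mapping.single k c) * h (Poly_Mapping.single l d)"
  shows "h (u * v) = h u * h v"
proof -
  interpret h: additive h by fact
  have 1: "h (Poly_Mapping.single k c * v) = h (Poly_Mapping.single k c) * h v" for k c
    by (rule additive_eq_on_singles) (auto intro!: additive.intro simp: distrib_left h.add s)
  show ?thesis
    by (rule additive_eq_on_singles[where v=u and f="\<lambda>u. h (u * v)" and g="\<lambda>u. h u * h v"])
      (auto intro!: additive.intro simp: distrib_right h.add 1)
qed

section \<open>Laurent polynomials\<close>

lemma lookup_laurent_conj: "Poly_Mapping.lookup (laurent_conj c) k = Poly_Mapping.lookup c (- k)"
  by (simp add: laurent_conj_def Poly_Mapping.map_key.rep_eq)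

lemma laurent_conj_add: "laurent_conj (c + d) = laurent_conj c + laurent_conj d"
  by (rule poly_mapping_eqI) (simp add: lookup_laurent_conj lookup_add)

lemma laurent_conj_0 [simp]: "laurent_conj 0 = 0"
  by (rule poly_mapping_eqI) (simp add: lookup_laurent_conj)

lemma laurent_conj_single:
  "laurent_conj (Poly_Mapping.single k c) = Poly_Mapping.single (- k) c"
  by (rule poly_mapping_eqI) (auto simp: lookup_laurent_conj lookup_single when_def)

lemma laurent_conj_mult: "laurent_conj (c * d) = laurent_conj c * laurent_conj d"
  by (rule mult_eq_on_singles)
    (auto intro!: additive.intro simp: laurent_conj_add laurent_conj_single mult_single)

lemma laurent_conj_of_int [simp]: "laurent_conj (of_int z) = of_int z"
proof -
  have "of_int z = (Poly_Mapping.single 0 z :: laurent)"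
    by (rule poly_mapping_eqI) (simp add: lookup_of_int lookup_single)
  then show ?thesis by (simp add: laurent_conj_single)
qed

lemma laurent_conj_qpow: "laurent_conj (qpow k) = qpow (- k)"
  by (simp add: qpow_def laurent_conj_single)

lemma laurent_conj_1 [simp]: "laurent_conj 1 = 1"
  using laurent_conj_of_int[of 1] by simp

lemma qpow_add: "qpow (k + l) = qpow k * qpow l"
  by (simp add: qpow_def mult_single)

lemma qpow_0 [simp]: "qpow 0 = 1"
  by (simp add: qpow_def)

lemma lookup_qpow_mult: "Poly_Mapping.lookup (qpow k * c) l = Poly_Mapping.lookup c (l - k)"
proof (rule additive_eq_on_singles[where v = c])
  show "Poly_Mapping.lookup (qpow k * Poly_Mapping.single i a) l
      = Poly_Mapping.lookup (Poly_Mapping.single i a) (l - k)" for i a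
    by (auto simp: qpow_def mult_single lookup_single when_def)
qed (auto intro!: additive.intro simp: algebra_simps lookup_add)

lemma poly_in_qinv_iff: "c \<in> poly_in_qinv \<longleftrightarrow> (\<forall>k>0. Poly_Mapping.lookup c k = 0)"
proof -
  have "c \<in> poly_in_qinv \<longleftrightarrow> (\<forall>k. Poly_Mapping.lookup c k \<noteq> 0 \<longrightarrow> k \<le> 0)"
    unfolding poly_in_qinv_def by (auto simp only: subset_eq in_keys_iff mem_Collect_eq atMost_iff)
  also have "\<dots> \<longleftrightarrow> (\<forall>k>0. Poly_Mapping.lookup c k = 0)"
    by (meson not_le)
  finally show ?thesis .
qed

lemma poly_in_qinv_0 [simp]: "0 \<in> poly_in_qinv"
  by (simp add: poly_in_qinv_iff)

lemma poly_in_qinv_add: "c \<in> poly_in_qinv \<Longrightarrow> d \<in> poly_in_qinv \<Longrightarrow> c + d \<in> poly_in_qinv"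
  by (simp add: poly_in_qinv_iff lookup_add)

lemma poly_in_qinv_mult: "c \<in> poly_in_qinv \<Longrightarrow> d \<in> poly_in_qinv \<Longrightarrow> c * d \<in> poly_in_qinv"
  using keys_mult[of c d] unfolding poly_in_qinv_def by fastforce

lemma poly_in_qinv_of_int [simp]: "of_int z \<in> poly_in_qinv"
  by (auto simp: poly_in_qinv_iff lookup_of_int)

lemma poly_in_qinv_1 [simp]: "1 \<in> poly_in_qinv"
  using poly_in_qinv_of_int[of 1] by simp

lemma poly_in_qinv_uminus: "c \<in> poly_in_qinv \<Longrightarrow> - c \<in> poly_in_qinv"
  by (simp add: poly_in_qinv_iff)

lemma poly_in_qinv_qpow: "k \<le> 0 \<Longrightarrow> qpow k \<in> poly_in_qinv"
  by (simp add: poly_in_qinv_def qpow_def)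

lemma constant_tail_zero:
  fixes c :: laurent
  assumes "\<And>k. k > b \<Longrightarrow> Poly_Mapping.lookup c k = Poly_Mapping.lookup c (k + 1)" and "k > b"
  shows "Poly_Mapping.lookup c k = 0"
proof (rule ccontr)
  assume nz: "Poly_Mapping.lookup c k \<noteq> 0"
  have "Poly_Mapping.lookup c (k + int m) = Poly_Mapping.lookup c k" for m
  proof (induction m)
    case (Suc m)
    then show ?case
      using assms(1)[of "k + int m"] assms(2) by (simp add: ac_simps)
  qed simp
  then have "range (\<lambda>m. k + int m) \<subseteq> Poly_Mapping.keys c"
    using nz by (auto simp: in_keys_iff)
  moreover have "infinite (range (\<lambda>m. k + int m))"
    by (rule range_inj_infinite) (simp add: inj_on_def)
  ultimately show False
    using finite_subset finite_keys by blast
qed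

text \<open>
  The extreme terms of a product with \<open>1 - q\<^sup>-\<^sup>1\<close> cannot cancel, so that division by this factor
  shortens the range of exponents. In particular no nonzero Laurent polynomial is divisible by all its
  powers.
\<close>

lemma keys_div_one_minus_qinv:
  assumes c: "Poly_Mapping.keys ((1 - qpow (- 1)) * c) \<subseteq> {a..b}"
  shows "Poly_Mapping.keys c \<subseteq> {a + 1..b}"
proof -
  have l: "Poly_Mapping.lookup ((1 - qpow (- 1)) * c) k
      = Poly_Mapping.lookup c k - Poly_Mapping.lookup c (k + 1)" for k
    by (simp add: left_diff_distrib lookup_minus lookup_qpow_mult)
  have out: "Poly_Mapping.lookup c k = Poly_Mapping.lookup c (k + 1)" if "k < a \<or> k > b" for k
  proof -
    have "k \<notin> Poly_Mapping.keys ((1 - qpow (- 1)) * c)"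
      using c that by (meson atLeastAtMost_iff not_le subsetD)
    then have "Poly_Mapping.lookup ((1 - qpow (- 1)) * c) k = 0"
      by (simp only: in_keys_iff not_not)
    then show ?thesis by (simp only: l right_minus_eq)
  qed
  have up: "Poly_Mapping.lookup c k = 0" if "k > b" for k
    by (rule constant_tail_zero[OF out that]) (rule disjI2)
  have "Poly_Mapping.lookup (laurent_conj c) k = 0" if "k > - a - 1" for k
  proof (rule constant_tail_zero[OF _ that])
    fix k assume "k > - a - 1"
    then show "Poly_Mapping.lookup (laurent_conj c) k = Poly_Mapping.lookup (laurent_conj c) (k + 1)"
      using out[of "- k - 1"] by (simp add: lookup_laurent_conj)
  qed
  from this[of "- k" for k] have down: "Poly_Mapping.lookup c k = 0" if "k < a + 1" for k
    using that by (simp add: lookup_laurent_conj)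
  show ?thesis
  proof
    fix k assume "k \<in> Poly_Mapping.keys c"
    then show "k \<in> {a + 1..b}"
      using up[of k] down[of k] unfolding in_keys_iff atLeastAtMost_iff by (meson not_le)
  qed
qed

section \<open>The relations of the Fock space\<close>

abbreviation relation_span :: "nat \<Rightarrow> prefock set" where
  "relation_span n \<equiv> prefock.span (relators n)"

lemma additive_prescale: "additive (prescale c)"
  by (rule additive.intro) (rule prefock.scale_right_distrib)

lemma prescale_preket: "prescale c (preket \<mu>) = Poly_Mapping.single \<mu> c"
  by (rule poly_mapping_eqI) (simp add: lookup_prescale preket_def lookup_single when_def)

lemma relation_congruent:
  assumes "int n dvd b - a"
  shows "preket (xs @ [a, b] @ ys) + preket (xs @ [b, a] @ ys) \<in> relation_span n"
proof -
  obtain k where k: "b = a + k * int n"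
    using assms by (metis add.commute diff_eq_eq dvdE mult.commute)
  consider "a = b" | "a < b" | "b < a" by linarith
  then show ?thesis
  proof cases
    case 1
    then show ?thesis
      by (simp only:) (intro prefock.span_add prefock.span_base relators.equal)
  next
    case 2
    then show ?thesis
      by (intro prefock.span_base relators.j_zero[OF _ k])
  next
    case 3
    then have "preket (xs @ [b, a] @ ys) + preket (xs @ [a, b] @ ys) \<in> relators n"
      by (rule relators.j_zero[where k = "- k"]) (simp add: k)
    then show ?thesis
      by (subst add.commute) (rule prefock.span_base)
  qed
qed

text \<open>
  Read adjacent letters \<open>x + n m\<close> and \<open>y + n m'\<close> as \<open>x\<close> and \<open>y\<close> multiplied by the powers \<open>m\<close> and \<open>m'\<close>
  of two variables attached to the two positions. Then the sum below is the relator with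
  \<open>m = m' = 0\<close>, multiplied by a symmetrized monomial, and all relators between letters
  congruent to \<open>x\<close> and \<open>y\<close>, in this order, have this form; only for \<open>m = m'\<close> the sum is twice a relator. In this form the
  relations are visibly stable under symmetric polynomials.
\<close>

lemma relation_symmetrized:
  assumes "x < y" "y < x + int n"
  shows "preket (xs @ [x + int n * m, y + int n * m'] @ ys)
    + preket (xs @ [x + int n * m', y + int n * m] @ ys)
    + prescale (qpow (- 1)) (preket (xs @ [y + int n * m', x + int n * m] @ ys))
    + prescale (qpow (- 1)) (preket (xs @ [y + int n * m, x + int n * m'] @ ys)) \<in> relation_span n"
proof -
  have less: "preket (xs @ [x + int n * m, y + int n * m'] @ ys)
    + prescale (qpow (- 1)) (preket (xs @ [y + int n * m', x + int n * m] @ ys))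
    + preket (xs @ [x + int n * m', y + int n * m] @ ys)
    + prescale (qpow (- 1)) (preket (xs @ [y + int n * m, x + int n * m'] @ ys)) \<in> relators n"
    if "m < m'" for m m'
    using relators.generic[where n = n and xs = xs and ys = ys and a = "x + int n * m"
        and b = "y + int n * m'" and k = "m' - m" and j = "y - x"] that assms
    by (simp add: algebra_simps)
  have equal: "preket (xs @ [x + int n * m, y + int n * m] @ ys)
    + prescale (qpow (- 1)) (preket (xs @ [y + int n * m, x + int n * m] @ ys)) \<in> relators n" for m
    using relators.k_zero[where n = n and xs = xs and ys = ys and a = "x + int n * m"
        and b = "y + int n * m" and j = "y - x"] assms by simp
  consider "m < m'" | "m' < m" | "m' = m" by linarith
  then show ?thesis
  proof cases
    case 1
    from prefock.span_base[OF less[OF this]] show ?thesis by (simp add: ac_simps)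
  next
    case 2
    from prefock.span_base[OF less[OF this]] show ?thesis by (simp add: ac_simps)
  next
    case 3
    from prefock.span_add[OF prefock.span_base[OF equal[of m]] prefock.span_base[OF equal[of m]]]
    show ?thesis by (simp add: ac_simps 3)
  qed
qed

section \<open>Passing to the quotient\<close>

lemma abs_fock_eq_iff:
  "(abs_fock u :: 'n fock) = abs_fock v \<longleftrightarrow> u - v \<in> relation_span CARD('n)"
  using fock.abs_eq_iff[of u v] by (simp add: fock_rel_def)

lemma abs_fock_rep [simp]: "abs_fock (rep_fock x) = x"
  by (rule Quotient3_abs_rep[OF Quotient3_fock])

lemma abs_fock_add: "abs_fock (u + v) = abs_fock u + abs_fock v"
  by (simp add: plus_fock.abs_eq)

lemma abs_fock_scale: "abs_fock (prescale c u) = scale c (abs_fock u)"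
  by (simp add: scale.abs_eq)

lemma abs_fock_preket: "abs_fock (preket \<mu>) = ket \<mu>"
  by (simp add: ket.abs_eq)

lemma abs_fock_single: "abs_fock (Poly_Mapping.single \<mu> c) = scale c (ket \<mu>)"
  by (simp flip: prescale_preket add: abs_fock_scale abs_fock_preket)

lemma abs_fock_relation: "u \<in> relation_span CARD('n) \<longleftrightarrow> (abs_fock u :: 'n fock) = 0"
  using abs_fock_eq_iff[of u 0, where 'n = 'n] by (simp add: zero_fock.abs_eq)

interpretation abs_fock: additive abs_fock
  by (rule additive.intro) (rule abs_fock_add)

lemma relation_span_image:
  assumes h: "additive h"
    and scale: "\<And>c v. h (prescale c v) = prescale (\<theta> c) (h v)"
    and rel: "\<And>u. u \<in> relators n \<Longrightarrow> h u \<in> relation_span n"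
    and u: "u \<in> relation_span n"
  shows "h u \<in> relation_span n"
  using u
proof (induction rule: prefock.span_induct_alt)
  case base
  show ?case by (simp add: additive.zero[OF h] prefock.span_zero)
next
  case (step c x y)
  then show ?case
    by (simp add: additive.add[OF h] scale prefock.span_add prefock.span_scale rel)
qed

section \<open>The bar involution\<close>

lemma noncong_pairs_cong:
  assumes "list_all2 (\<lambda>x y. int n dvd x - y) \<mu> \<nu>"
  shows "noncong_pairs n \<mu> = noncong_pairs n \<nu>"
proof -
  have "int n dvd \<mu> ! i - \<mu> ! j \<longleftrightarrow> int n dvd \<nu> ! i - \<nu> ! j"
    if "i < length \<mu>" "j < length \<mu>" for i j
  proof -
    have "int n dvd \<mu> ! i - \<nu> ! i" "int n dvd \<mu> ! j - \<nu> ! j"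
      using assms that by (auto simp: list_all2_conv_all_nth)
    then have "int n dvd (\<mu> ! i - \<nu> ! i) - (\<mu> ! j - \<nu> ! j)"
      by (rule dvd_diff)
    moreover have "(\<mu> ! i - \<mu> ! j) = (\<nu> ! i - \<nu> ! j) + ((\<mu> ! i - \<nu> ! i) - (\<mu> ! j - \<nu> ! j))"
      by simp
    ultimately show ?thesis
      by (metis dvd_add_left_iff)
  qed
  then have "{(i, j). i < j \<and> j < length \<mu> \<and> \<not> int n dvd \<mu> ! i - \<mu> ! j}
      = {(i, j). i < j \<and> j < length \<nu> \<and> \<not> int n dvd \<nu> ! i - \<nu> ! j}"
    using assms[THEN list_all2_lengthD] by auto
  then show ?thesis by (simp add: noncong_pairs_def)
qed

lemma noncong_pairs_Cons:
  "noncong_pairs n (x # \<mu>) = length (filter (\<lambda>y. \<not> int n dvd x - y) \<mu>) + noncong_pairs n \<mu>"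
proof -
  let ?P = "\<lambda>\<mu>. {(i, j). i < j \<and> j < length \<mu> \<and> \<not> int n dvd \<mu> ! i - \<mu> ! j}"
  let ?J = "{j. j < length \<mu> \<and> \<not> int n dvd x - \<mu> ! j}"
  have fin: "finite (?P \<mu>)"
    by (rule finite_subset[of _ "{..<length \<mu>} \<times> {..<length \<mu>}"]) auto
  have eq: "?P (x # \<mu>) = (\<lambda>j. (0, Suc j)) ` ?J \<union> map_prod Suc Suc ` ?P \<mu>" (is "?A = ?B")
  proof
    show "?A \<subseteq> ?B"
    proof
      fix z assume "z \<in> ?A"
      then obtain i j where "z = (i, Suc j)" "i < Suc j" "j < length \<mu>"
          "\<not> int n dvd (x # \<mu>) ! i - \<mu> ! j"
        by (auto simp: less_Suc_eq_0_disj)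
      then show "z \<in> ?B" by (cases i) (auto simp: image_iff)
    qed
  qed auto
  have "card (?P (x # \<mu>)) = card ?J + card (?P \<mu>)"
    unfolding eq by (subst card_Un_disjoint)
      (auto simp: fin card_image inj_on_def)
  then show ?thesis
    by (simp add: noncong_pairs_def length_filter_conv_card)
qed

lemma noncong_pairs_swap:
  "noncong_pairs n (xs @ [a, b] @ ys) = noncong_pairs n (xs @ [b, a] @ ys)"
  by (induction xs) (auto simp: noncong_pairs_Cons dvd_diff_commute)

definition bar_coeff :: "nat \<Rightarrow> int list \<Rightarrow> laurent" where
  "bar_coeff n \<mu> = (- 1) ^ (length \<mu> * (length \<mu> - 1) div 2) * qpow (int (noncong_pairs n \<mu>))"

lemma bar_coeff_eqI:
  "noncong_pairs n \<mu> = noncong_pairs n \<nu> \<Longrightarrow> length \<mu> = length \<nu> \<Longrightarrow> bar_coeff n \<mu> = bar_coeff n \<nu>"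
  by (simp add: bar_coeff_def)

lemma prebar_eq_extend:
  "prebar n = extend (\<lambda>\<mu> c. prescale (laurent_conj c * bar_coeff n \<mu>) (preket (rev \<mu>)))"
  by (simp add: fun_eq_iff prebar_def extend_def bar_coeff_def mult.assoc)

interpretation prebar: additive "prebar n"
  unfolding prebar_eq_extend
  by (rule additive_extend, rule additive.intro)
    (simp add: laurent_conj_add distrib_right prefock.scale_left_distrib)

lemma prebar_single:
  "prebar n (Poly_Mapping.single \<mu> c)
    = Poly_Mapping.single (rev \<mu>) (laurent_conj c * bar_coeff n \<mu>)"
  unfolding prebar_eq_extend by (subst extend_single) (simp_all add: prescale_preket)

lemma prebar_preket: "prebar n (preket \<mu>) = prescale (bar_coeff n \<mu>) (preket (rev \<mu>))"
  by (simp add: preket_def prebar_single prescale_preket[unfolded preket_def])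

lemma prescale_single: "prescale c (Poly_Mapping.single \<mu> d) = Poly_Mapping.single \<mu> (c * d)"
  by (simp flip: prescale_preket)

lemma prebar_scale: "prebar n (prescale c v) = prescale (laurent_conj c) (prebar n v)"
proof (rule additive_eq_on_singles[where v = v])
  show "prebar n (prescale c (Poly_Mapping.single \<mu> d))
      = prescale (laurent_conj c) (prebar n (Poly_Mapping.single \<mu> d))" for \<mu> d
    by (simp add: prescale_single prebar_single laurent_conj_mult mult.assoc)
qed (auto intro!: additive.intro simp: prebar.add prefock.scale_right_distrib)

lemma qpow_cancel: "qpow 1 * (c * qpow (- 1)) = c"
  by (simp add: mult.left_commute flip: qpow_add)

text \<open>
  Up to order and multiples of \<open>n\<close>, all weights in a relator have the same entries, hence the
  same number of noncongruent pairs. The bar map therefore turns a relator into a multiple of the relator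
  for the same two letters between reversed words.
\<close>

lemma prebar_relators:
  assumes "u \<in> relators n"
  shows "prebar n u \<in> relation_span n"
  using assms
proof cases
  case (equal xs a ys)
  have "preket (rev (xs @ [a, a] @ ys)) \<in> relators n"
    using relators.equal[of "rev ys" a "rev xs" n] by simp
  then show ?thesis
    unfolding equal prebar_preket by (intro prefock.span_scale prefock.span_base)
next
  case (j_zero a b k xs ys)
  have c1: "bar_coeff n (xs @ [b, a] @ ys) = bar_coeff n (xs @ [a, b] @ ys)"
    by (rule bar_coeff_eqI[OF noncong_pairs_swap]) simp
  have "prebar n u = prescale (bar_coeff n (xs @ [a, b] @ ys))
      (preket (rev ys @ [a, b] @ rev xs) + preket (rev ys @ [b, a] @ rev xs))"
    unfolding j_zero(1)
    by (simp add: prebar.add prebar_preket prefock.scale_right_distrib add.commute c1[simplified])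
  moreover have "\<dots> \<in> relation_span n"
    by (intro prefock.span_scale prefock.span_base relators.j_zero[OF j_zero(2,3)])
  ultimately show ?thesis by simp
next
  case (k_zero a b j xs ys)
  have c1: "bar_coeff n (xs @ [b, a] @ ys) = bar_coeff n (xs @ [a, b] @ ys)"
    by (rule bar_coeff_eqI[OF noncong_pairs_swap]) simp
  have "prebar n u = prescale (qpow 1 * bar_coeff n (xs @ [a, b] @ ys))
      (preket (rev ys @ [a, b] @ rev xs) + prescale (qpow (- 1)) (preket (rev ys @ [b, a] @ rev xs)))"
    unfolding k_zero(1)
    by (simp add: prebar.add prebar_scale prebar_preket prefock.scale_right_distrib add.commute
        c1[simplified] laurent_conj_qpow
        mult.assoc mult.left_commute qpow_cancel flip: qpow_add)
  moreover have "\<dots> \<in> relation_span n"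
    by (intro prefock.span_scale prefock.span_base relators.k_zero[OF k_zero(2-4)])
  ultimately show ?thesis by simp
next
  case (generic b a k j xs ys)
  let ?c = "bar_coeff n (xs @ [a, b] @ ys)"
  have c1: "bar_coeff n (xs @ [b, a] @ ys) = ?c"
    by (rule bar_coeff_eqI[OF noncong_pairs_swap]) simp
  have c2: "bar_coeff n (xs @ [a + k * int n, b - k * int n] @ ys) = ?c"
    by (rule bar_coeff_eqI[OF noncong_pairs_cong])
      (auto intro!: list_all2_appendI list_all2_refl)
  have c3: "bar_coeff n (xs @ [b - k * int n, a + k * int n] @ ys) = ?c"
    unfolding c2[symmetric] by (rule bar_coeff_eqI[OF noncong_pairs_swap]) simp
  have "prebar n u = prescale (qpow 1 * ?c)
      (preket (rev ys @ [a, b] @ rev xs)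
       + prescale (qpow (- 1)) (preket (rev ys @ [b, a] @ rev xs))
       + preket (rev ys @ [a + k * int n, b - k * int n] @ rev xs)
       + prescale (qpow (- 1)) (preket (rev ys @ [b - k * int n, a + k * int n] @ rev xs)))"
    unfolding generic(1)
    by (simp add: prebar.add prebar_scale prebar_preket prefock.scale_right_distrib
        c1[simplified] c2[simplified] c3[simplified] laurent_conj_qpow
        mult.assoc mult.left_commute qpow_cancel flip: qpow_add)
  moreover have "\<dots> \<in> relation_span n"
    by (intro prefock.span_scale prefock.span_base relators.generic[OF generic(2-5)])
  ultimately show ?thesis by simp
qed

lemma prebar_relation_span:
  assumes "u \<in> relation_span n" shows "prebar n u \<in> relation_span n"
  by (rule relation_span_image[OF prebar.additive_axioms prebar_scale prebar_relators assms])

lemma bar_abs_fock: "bar (abs_fock v :: 'n fock) = abs_fock (prebar CARD('n) v)"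
proof -
  have "rep_fock (abs_fock v :: 'n fock) - v \<in> relation_span CARD('n)"
    by (simp flip: abs_fock_eq_iff)
  from prebar_relation_span[OF this] show ?thesis
    by (simp add: bar_def abs_fock_eq_iff prebar.diff)
qed

lemma fock_cases: obtains v where "x = abs_fock v"
  by (metis abs_fock_rep)

lemma bar_add: "bar (x + y) = bar x + bar y"
  by (cases x rule: fock_cases; cases y rule: fock_cases)
    (simp add: bar_abs_fock prebar.add flip: abs_fock_add)

interpretation bar: additive "bar :: 'n fock \<Rightarrow> 'n fock"
  by (rule additive.intro) (rule bar_add)

lemma bar_scale: "bar (scale c x) = scale (laurent_conj c) (bar x)"
  by (cases x rule: fock_cases)
    (simp add: bar_abs_fock prebar_scale flip: abs_fock_scale)

section \<open>Symmetric Laurent polynomials act on the Fock space\<close>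

definition shift :: "nat \<Rightarrow> (nat \<Rightarrow> int) \<Rightarrow> int list \<Rightarrow> int list" where
  "shift n g \<mu> = map (\<lambda>i. \<mu> ! i + int n * g i) [0..<length \<mu>]"

lemma length_shift [simp]: "length (shift n g \<mu>) = length \<mu>"
  by (simp add: shift_def)

lemma nth_shift: "i < length \<mu> \<Longrightarrow> shift n g \<mu> ! i = \<mu> ! i + int n * g i"
  by (simp add: shift_def)

lemma shift_split:
  "shift n g (xs @ [a, b] @ ys) = shift n g xs
     @ [a + int n * g (length xs), b + int n * g (Suc (length xs))]
     @ shift n (\<lambda>i. g (i + length xs + 2)) ys"
proof (rule nth_equalityI)
  fix i assume i: "i < length (shift n g (xs @ [a, b] @ ys))"
  consider "i < length xs" | "i = length xs" | "i = Suc (length xs)"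
    | j where "i = j + length xs + 2" "j < length ys"
    using i that(4)[of "i - length xs - 2"] by fastforce
  then show "shift n g (xs @ [a, b] @ ys) ! i = (shift n g xs
     @ [a + int n * g (length xs), b + int n * g (Suc (length xs))]
     @ shift n (\<lambda>i. g (i + length xs + 2)) ys) ! i"
    using i by cases (simp_all add: nth_shift nth_append)
qed simp

lemma shift_cong: "(\<And>i. i < length \<mu> \<Longrightarrow> g i = h i) \<Longrightarrow> shift n g \<mu> = shift n h \<mu>"
  by (simp add: shift_def)

lemma rev_shift: "rev (shift n g \<mu>) = shift n (\<lambda>i. g (length \<mu> - 1 - i)) (rev \<mu>)"
  by (rule nth_equalityI) (simp_all add: nth_shift rev_nth)

definition permute_exponent :: "(nat \<Rightarrow> nat) \<Rightarrow> (nat \<Rightarrow>\<^sub>0 int) \<Rightarrow> (nat \<Rightarrow>\<^sub>0 int)" where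
  "permute_exponent \<pi> \<beta> = Poly_Mapping.map_key \<pi> \<beta>"

lemma lookup_permute_exponent:
  "inj \<pi> \<Longrightarrow> Poly_Mapping.lookup (permute_exponent \<pi> \<beta>) i = Poly_Mapping.lookup \<beta> (\<pi> i)"
  by (simp add: permute_exponent_def Poly_Mapping.map_key.rep_eq)

definition symmetric_in :: "nat \<Rightarrow> mlaurent \<Rightarrow> bool" where
  "symmetric_in r f \<longleftrightarrow> (\<forall>\<pi> \<beta>. \<pi> permutes {..<r} \<longrightarrow>
     Poly_Mapping.lookup f (permute_exponent \<pi> \<beta>) = Poly_Mapping.lookup f \<beta>)"

lemma bij_permute_exponent: "\<pi> permutes S \<Longrightarrow> bij (permute_exponent \<pi>)"
proof (rule o_bij)
  assume p: "\<pi> permutes S"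
  note i = permutes_inj[OF p] permutes_inj[OF permutes_inv[OF p]]
  show "permute_exponent (inv_into UNIV \<pi>) \<circ> permute_exponent \<pi> = id"
    "permute_exponent \<pi> \<circ> permute_exponent (inv_into UNIV \<pi>) = id"
    by (auto intro!: ext poly_mapping_eqI simp: lookup_permute_exponent i permutes_inverses[OF p])
qed

lemma sum_keys_symmetric:
  assumes f: "symmetric_in r f" and \<pi>: "\<pi> permutes {..<r}"
  shows "(\<Sum>\<beta>\<in>Poly_Mapping.keys f. T (permute_exponent \<pi> \<beta>)) = (\<Sum>\<beta>\<in>Poly_Mapping.keys f. T \<beta>)"
proof (rule sum.reindex_bij_betw)
  note b = bij_permute_exponent[OF \<pi>]
  have "permute_exponent \<pi> ` Poly_Mapping.keys f = Poly_Mapping.keys f"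
  proof (intro equalityI subsetI)
    fix \<beta> assume \<beta>: "\<beta> \<in> Poly_Mapping.keys f"
    obtain \<gamma> where "\<beta> = permute_exponent \<pi> \<gamma>" using bij_pointE[OF b] by metis
    with \<beta> f \<pi> show "\<beta> \<in> permute_exponent \<pi> ` Poly_Mapping.keys f"
      by (auto simp: symmetric_in_def in_keys_iff)
  qed (use f \<pi> in \<open>auto simp: symmetric_in_def in_keys_iff\<close>)
  then show "bij_betw (permute_exponent \<pi>) (Poly_Mapping.keys f) (Poly_Mapping.keys f)"
    using b by (metis bij_betw_subset subset_UNIV)
qed

lemma precenter_act_eq_extend:
  "precenter_act n r f = extend (\<lambda>\<mu> c. if length \<mu> = r then
     (\<Sum>\<beta>\<in>Poly_Mapping.keys f. prescale (of_int (Poly_Mapping.lookup f \<beta>) * c)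
        (preket (shift n (\<lambda>i. - Poly_Mapping.lookup \<beta> i) \<mu>))) else 0)"
  unfolding fun_eq_iff precenter_act_def extend_def
  by (intro allI, subst sum.inter_filter) (auto intro!: sum.cong simp: shift_def)

interpretation precenter_act: additive "precenter_act n r f"
  unfolding precenter_act_eq_extend
  by (rule additive_extend, rule additive.intro)
    (simp add: distrib_left prefock.scale_left_distrib sum.distrib)

lemma precenter_act_single:
  assumes "length \<mu> = r"
  shows "precenter_act n r f (Poly_Mapping.single \<mu> c)
    = (\<Sum>\<beta>\<in>Poly_Mapping.keys f. Poly_Mapping.single
        (shift n (\<lambda>i. - Poly_Mapping.lookup \<beta> i) \<mu>) (of_int (Poly_Mapping.lookup f \<beta>) * c))"
  unfolding precenter_act_eq_extend using assms
  by (subst extend_single) (simp_all add: prescale_preket)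

lemma precenter_act_single_other_rank:
  "length \<mu> \<noteq> r \<Longrightarrow> precenter_act n r f (Poly_Mapping.single \<mu> c) = 0"
  unfolding precenter_act_eq_extend by (subst extend_single) simp_all

lemma precenter_act_scale: "precenter_act n r f (prescale c v) = prescale c (precenter_act n r f v)"
proof (rule additive_eq_on_singles[where v = v])
  fix \<mu> d
  show "precenter_act n r f (prescale c (Poly_Mapping.single \<mu> d))
      = prescale c (precenter_act n r f (Poly_Mapping.single \<mu> d))"
    by (cases "length \<mu> = r")
      (simp_all add: prescale_single precenter_act_single precenter_act_single_other_rank
        additive.sum[OF additive_prescale] mult.left_commute)
qed (auto intro!: additive.intro simp: precenter_act.add prefock.scale_right_distrib)

lemma precenter_act_preket:
  assumes "length \<mu> = r"
  shows "precenter_act n r f (preket \<mu>)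
    = (\<Sum>\<beta>\<in>Poly_Mapping.keys f. prescale (of_int (Poly_Mapping.lookup f \<beta>))
        (preket (shift n (\<lambda>i. - Poly_Mapping.lookup \<beta> i) \<mu>)))"
  using precenter_act_single[OF assms, of n f 1] by (simp add: preket_def prescale_preket[unfolded preket_def])

text \<open>
  A sum over the exponents of a symmetric polynomial splits into pairs exchanged by an adjacent
  transposition and into fixed exponents. The fixed exponents have their own hypothesis because
  the pairing only controls twice their contribution.
\<close>

lemma symmetric_sum_in_relation_span:
  assumes f: "symmetric_in r f" and i: "Suc i < r"
    and fixed: "\<And>\<beta>. Poly_Mapping.lookup \<beta> i = Poly_Mapping.lookup \<beta> (Suc i) \<Longrightarrow> T \<beta> \<in> relation_span n"
    and pair: "\<And>\<beta>. T \<beta> + T (permute_exponent (Transposition.transpose i (Suc i)) \<beta>) \<in> relation_span n"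
  shows "(\<Sum>\<beta>\<in>Poly_Mapping.keys f. prescale (of_int (Poly_Mapping.lookup f \<beta>)) (T \<beta>)) \<in> relation_span n"
proof -
  let ?K = "Poly_Mapping.keys f"
  let ?\<sigma> = "permute_exponent (Transposition.transpose i (Suc i))"
  let ?F = "\<lambda>\<beta>. prescale (of_int (Poly_Mapping.lookup f \<beta>)) (T \<beta>)"
  let ?less = "\<lambda>\<beta>. Poly_Mapping.lookup \<beta> i < Poly_Mapping.lookup \<beta> (Suc i)"
  let ?greater = "\<lambda>\<beta>. Poly_Mapping.lookup \<beta> (Suc i) < Poly_Mapping.lookup \<beta> i"
  have p: "Transposition.transpose i (Suc i) permutes {..<r}"
    by (rule permutes_swap_id) (use i in auto)
  have lk: "Poly_Mapping.lookup (?\<sigma> \<beta>) j = Poly_Mapping.lookup \<beta> (Transposition.transpose i (Suc i) j)" for \<beta> j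
    by (rule lookup_permute_exponent) (rule permutes_inj[OF p])
  have fs: "Poly_Mapping.lookup f (?\<sigma> \<beta>) = Poly_Mapping.lookup f \<beta>" for \<beta>
    using f p by (simp add: symmetric_in_def)
  have "(\<Sum>\<beta>\<in>?K. ?F \<beta>) = (\<Sum>\<beta>\<in>?K. if ?less \<beta> then ?F \<beta> else 0)
      + (\<Sum>\<beta>\<in>?K. if ?greater \<beta> then ?F \<beta> else 0)
      + (\<Sum>\<beta>\<in>?K. if \<not> ?less \<beta> \<and> \<not> ?greater \<beta> then ?F \<beta> else 0)"
    unfolding sum.distrib[symmetric] by (rule sum.cong) auto
  also have "(\<Sum>\<beta>\<in>?K. if ?greater \<beta> then ?F \<beta> else 0)
      = (\<Sum>\<beta>\<in>?K. if ?greater (?\<sigma> \<beta>) then ?F (?\<sigma> \<beta>) else 0)"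
    by (rule sum_keys_symmetric[OF f p, symmetric])
  also have "\<dots> = (\<Sum>\<beta>\<in>?K. if ?less \<beta> then prescale (of_int (Poly_Mapping.lookup f \<beta>)) (T (?\<sigma> \<beta>)) else 0)"
    by (simp add: lk fs cong: if_cong)
  also have "(\<Sum>\<beta>\<in>?K. if ?less \<beta> then ?F \<beta> else 0) + \<dots>
      = (\<Sum>\<beta>\<in>?K. if ?less \<beta> then prescale (of_int (Poly_Mapping.lookup f \<beta>)) (T \<beta> + T (?\<sigma> \<beta>)) else 0)"
    unfolding sum.distrib[symmetric] by (rule sum.cong) (auto simp: prefock.scale_right_distrib)
  also have "\<dots> + (\<Sum>\<beta>\<in>?K. if \<not> ?less \<beta> \<and> \<not> ?greater \<beta> then ?F \<beta> else 0) \<in> relation_span n"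
    by (intro prefock.span_add prefock.span_sum)
      (auto intro!: prefock.span_scale pair fixed prefock.span_zero)
  finally show ?thesis .
qed

text \<open>
  The product of a relator with a monomial in which both variables of the relator have equal degree is
  a relator between shifted words. For a general monomial, adding the product with the transposed
  monomial produces relations in symmetrized form.
\<close>

lemma precenter_act_relators:
  assumes f: "symmetric_in r f" and u: "u \<in> relators n"
  shows "precenter_act n r f u \<in> relation_span n"
proof -
  let ?\<sigma> = "\<lambda>xs :: int list. permute_exponent (Transposition.transpose (length xs) (Suc (length xs)))"
  \<comment> \<open>the ket of \<open>xs @ [a, b] @ ys\<close>, multiplied by the monomial with exponent \<open>\<beta>\<close>\<close>
  define w where "w xs ys a b \<beta> = preket (shift n (\<lambda>i. - Poly_Mapping.lookup \<beta> i) xs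
      @ [a + int n * - Poly_Mapping.lookup \<beta> (length xs),
         b + int n * - Poly_Mapping.lookup \<beta> (Suc (length xs))]
      @ shift n (\<lambda>i. - Poly_Mapping.lookup \<beta> (i + length xs + 2)) ys)"
    for xs ys a b and \<beta> :: "nat \<Rightarrow>\<^sub>0 int"
  have act: "precenter_act n r f (preket (xs @ [a, b] @ ys))
      = (\<Sum>\<beta>\<in>Poly_Mapping.keys f. prescale (of_int (Poly_Mapping.lookup f \<beta>)) (w xs ys a b \<beta>))"
    if "length xs + 2 + length ys = r" for xs ys a b
    using that by (subst precenter_act_preket) (simp_all only: w_def shift_split, simp)
  have other: "precenter_act n r f (preket (xs @ [a, b] @ ys)) = 0"
    if "length xs + 2 + length ys \<noteq> r" for xs ys a b
    using that by (simp add: preket_def precenter_act_single_other_rank)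
  have swapped: "w xs ys a b (?\<sigma> xs \<beta>)
      = preket (shift n (\<lambda>i. - Poly_Mapping.lookup \<beta> i) xs
          @ [a + int n * - Poly_Mapping.lookup \<beta> (Suc (length xs)),
             b + int n * - Poly_Mapping.lookup \<beta> (length xs)]
          @ shift n (\<lambda>i. - Poly_Mapping.lookup \<beta> (i + length xs + 2)) ys)" for xs ys a b \<beta>
    unfolding w_def
    by (simp add: lookup_permute_exponent, intro arg_cong2[where f = "\<lambda>xs ys. preket (xs @ _ # _ # ys)"] shift_cong)
      (simp_all add: transpose_apply_other)
  have sum_in: "(\<Sum>\<beta>\<in>Poly_Mapping.keys f. prescale (of_int (Poly_Mapping.lookup f \<beta>)) (T \<beta>)) \<in> relation_span n"
    if "length xs + 2 + length ys = r"
      "\<And>\<beta>. Poly_Mapping.lookup \<beta> (length xs) = Poly_Mapping.lookup \<beta> (Suc (length xs)) \<Longrightarrow> T \<beta> \<in> relation_span n"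
      "\<And>\<beta>. T \<beta> + T (?\<sigma> xs \<beta>) \<in> relation_span n"
    for xs ys :: "int list" and T
    by (rule symmetric_sum_in_relation_span[OF f, where i = "length xs"]) (use that in auto)
  note expand = precenter_act.add precenter_act_scale act sum.distrib prefock.scale_right_distrib
    prefock.scale_sum_right prefock.scale_scale mult.commute
  show ?thesis
    using u
  proof cases
    case (equal xs a ys)
    show ?thesis
    proof (cases "length xs + 2 + length ys = r")
      case True
      have "(\<Sum>\<beta>\<in>Poly_Mapping.keys f. prescale (of_int (Poly_Mapping.lookup f \<beta>)) (w xs ys a a \<beta>))
          \<in> relation_span n"
      proof (rule sum_in[OF True])
        show "w xs ys a a \<beta> \<in> relation_span n"
          if "Poly_Mapping.lookup \<beta> (length xs) = Poly_Mapping.lookup \<beta> (Suc (length xs))" for \<beta>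
          unfolding w_def that by (intro prefock.span_base relators.equal)
        show "w xs ys a a \<beta> + w xs ys a a (?\<sigma> xs \<beta>)
            \<in> relation_span n" for \<beta>
          unfolding swapped unfolding w_def by (rule relation_congruent) simp
      qed
      then show ?thesis unfolding equal act[OF True] .
    qed (simp only: equal other prefock.span_zero simp_thms)
  next
    case (j_zero a b k xs ys)
    show ?thesis
    proof (cases "length xs + 2 + length ys = r")
      case True
      have "(\<Sum>\<beta>\<in>Poly_Mapping.keys f. prescale (of_int (Poly_Mapping.lookup f \<beta>)) (w xs ys a b \<beta> + w xs ys b a \<beta>))
          \<in> relation_span n"
      proof (rule sum_in[OF True])
        show "w xs ys a b \<beta> + w xs ys b a \<beta> \<in> relation_span n"
          if "Poly_Mapping.lookup \<beta> (length xs) = Poly_Mapping.lookup \<beta> (Suc (length xs))" for \<beta>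
          unfolding w_def that by (rule relation_congruent) (simp add: j_zero(3))
        show "w xs ys a b \<beta> + w xs ys b a \<beta>
            + (w xs ys a b (?\<sigma> xs \<beta>)
               + w xs ys b a (?\<sigma> xs \<beta>))
            \<in> relation_span n" for \<beta>
        proof -
          let ?p = "- Poly_Mapping.lookup \<beta> (length xs)" and ?q = "- Poly_Mapping.lookup \<beta> (Suc (length xs))"
          have "int n dvd (b + int n * ?q) - (a + int n * ?p)" "int n dvd (a + int n * ?q) - (b + int n * ?p)"
            by (simp_all add: j_zero(3) dvd_diff dvd_add)
          from prefock.span_add[OF this[THEN relation_congruent[where xs = "shift n (\<lambda>i. - Poly_Mapping.lookup \<beta> i) xs"
              and ys = "shift n (\<lambda>i. - Poly_Mapping.lookup \<beta> (i + length xs + 2)) ys"]]] show ?thesis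
            unfolding swapped unfolding w_def by (simp only: ac_simps)
        qed
      qed
      then show ?thesis unfolding j_zero(1) by (simp only: expand True)
    qed (simp only: j_zero(1) other precenter_act.add add_0 prefock.span_zero simp_thms)
  next
    case (k_zero a b j xs ys)
    show ?thesis
    proof (cases "length xs + 2 + length ys = r")
      case True
      have "(\<Sum>\<beta>\<in>Poly_Mapping.keys f. prescale (of_int (Poly_Mapping.lookup f \<beta>))
          (w xs ys a b \<beta> + prescale (qpow (- 1)) (w xs ys b a \<beta>))) \<in> relation_span n"
      proof (rule sum_in[OF True])
        show "w xs ys a b \<beta> + prescale (qpow (- 1)) (w xs ys b a \<beta>) \<in> relation_span n"
          if "Poly_Mapping.lookup \<beta> (length xs) = Poly_Mapping.lookup \<beta> (Suc (length xs))" for \<beta>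
          unfolding w_def that
          by (intro prefock.span_base relators.k_zero[where j = j]) (use k_zero in auto)
        show "w xs ys a b \<beta> + prescale (qpow (- 1)) (w xs ys b a \<beta>)
            + (w xs ys a b (?\<sigma> xs \<beta>)
               + prescale (qpow (- 1)) (w xs ys b a (?\<sigma> xs \<beta>)))
            \<in> relation_span n" for \<beta>
          using relation_symmetrized[OF k_zero(2), of n _ "- Poly_Mapping.lookup \<beta> (length xs)"
              "- Poly_Mapping.lookup \<beta> (Suc (length xs))"] k_zero
          unfolding swapped unfolding w_def by (simp only: ac_simps)
      qed
      then show ?thesis unfolding k_zero(1) by (simp only: expand True)
    qed (simp only: k_zero(1) other precenter_act.add precenter_act_scale prefock.scale_zero_right add_0 prefock.span_zero simp_thms)
  next
    case (generic b a k j xs ys)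
    show ?thesis
    proof (cases "length xs + 2 + length ys = r")
      case True
      have "(\<Sum>\<beta>\<in>Poly_Mapping.keys f. prescale (of_int (Poly_Mapping.lookup f \<beta>))
          (w xs ys a b \<beta> + prescale (qpow (- 1)) (w xs ys b a \<beta>)
           + w xs ys (a + k * int n) (b - k * int n) \<beta>
           + prescale (qpow (- 1)) (w xs ys (b - k * int n) (a + k * int n) \<beta>))) \<in> relation_span n"
      proof (rule sum_in[OF True])
        show "w xs ys a b \<beta> + prescale (qpow (- 1)) (w xs ys b a \<beta>)
           + w xs ys (a + k * int n) (b - k * int n) \<beta>
           + prescale (qpow (- 1)) (w xs ys (b - k * int n) (a + k * int n) \<beta>) \<in> relation_span n"
          if e: "Poly_Mapping.lookup \<beta> (length xs) = Poly_Mapping.lookup \<beta> (Suc (length xs))" for \<beta>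
        proof -
          let ?p = "int n * - Poly_Mapping.lookup \<beta> (Suc (length xs))"
          have "b + ?p = (a + ?p) + k * int n + j" by (simp add: generic(2))
          from prefock.span_base[OF relators.generic[OF this generic(3-5)]] show ?thesis
            unfolding w_def e by (simp only: algebra_simps)
        qed
        show "w xs ys a b \<beta> + prescale (qpow (- 1)) (w xs ys b a \<beta>)
            + w xs ys (a + k * int n) (b - k * int n) \<beta>
            + prescale (qpow (- 1)) (w xs ys (b - k * int n) (a + k * int n) \<beta>)
            + (w xs ys a b (?\<sigma> xs \<beta>)
               + prescale (qpow (- 1)) (w xs ys b a (?\<sigma> xs \<beta>))
               + w xs ys (a + k * int n) (b - k * int n) (?\<sigma> xs \<beta>)
               + prescale (qpow (- 1)) (w xs ys (b - k * int n) (a + k * int n) (?\<sigma> xs \<beta>)))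
            \<in> relation_span n" for \<beta>
        proof -
          let ?p = "- Poly_Mapping.lookup \<beta> (length xs)" and ?q = "- Poly_Mapping.lookup \<beta> (Suc (length xs))"
          have lt: "a < a + j" "a + j < a + int n" using generic by auto
          have e: "b + int n * m = a + j + int n * (m + k)" "b - k * int n + int n * m = a + j + int n * m"
            "a + k * int n + int n * m = a + int n * (m + k)" for m
            by (simp_all add: generic(2) algebra_simps)
          \<comment> \<open>The symmetrized monomials with exponents \<open>(0, k)\<close> and \<open>(p, q)\<close> multiply to the sum of
            those with exponents \<open>(p, q + k)\<close> and \<open>(q, p + k)\<close>.\<close>
          show ?thesis
            using prefock.span_add[OF relation_symmetrized[OF lt, where xs = "shift n (\<lambda>i. - Poly_Mapping.lookup \<beta> i) xs"
              and ys = "shift n (\<lambda>i. - Poly_Mapping.lookup \<beta> (i + length xs + 2)) ys" and m = ?p and m' = "?q + k"]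
                relation_symmetrized[OF lt, where xs = "shift n (\<lambda>i. - Poly_Mapping.lookup \<beta> i) xs"
              and ys = "shift n (\<lambda>i. - Poly_Mapping.lookup \<beta> (i + length xs + 2)) ys" and m = ?q and m' = "?p + k"]]
            unfolding swapped unfolding w_def e by (simp only: ac_simps)
        qed
      qed
      then show ?thesis unfolding generic(1) by (simp only: expand True)
    qed (simp only: generic(1) other precenter_act.add precenter_act_scale prefock.scale_zero_right add_0 prefock.span_zero simp_thms)
  qed
qed

lemma precenter_act_relation_span:
  assumes "symmetric_in r f" and "u \<in> relation_span n"
  shows "precenter_act n r f u \<in> relation_span n"
  by (rule relation_span_image[OF precenter_act.additive_axioms precenter_act_scale
        precenter_act_relators[OF assms(1)] assms(2)])

lemma center_act_abs_fock:
  assumes "symmetric_in r f"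
  shows "center_act r f (abs_fock v :: 'n fock) = abs_fock (precenter_act CARD('n) r f v)"
proof -
  have "rep_fock (abs_fock v :: 'n fock) - v \<in> relation_span CARD('n)"
    by (simp flip: abs_fock_eq_iff)
  from precenter_act_relation_span[OF assms this] show ?thesis
    by (simp add: center_act_def abs_fock_eq_iff precenter_act.diff)
qed

lemma additive_center_act:
  assumes "symmetric_in r f"
  shows "additive (center_act r f :: 'n fock \<Rightarrow> 'n fock)"
proof (rule additive.intro)
  show "center_act r f (x + y) = center_act r f x + center_act r f y" for x y :: "'n fock"
    by (cases x rule: fock_cases; cases y rule: fock_cases)
      (simp add: center_act_abs_fock[OF assms] precenter_act.add flip: abs_fock_add)
qed

lemma center_act_scale:
  assumes "symmetric_in r f"
  shows "center_act r f (scale c x) = scale c (center_act r f x)"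
  by (cases x rule: fock_cases)
    (simp add: center_act_abs_fock[OF assms] precenter_act_scale flip: abs_fock_scale)

lemma center_act_ket:
  assumes "symmetric_in r f" and "length \<mu> = r"
  shows "center_act r f (ket \<mu> :: 'n fock)
    = (\<Sum>\<beta>\<in>Poly_Mapping.keys f. scale (of_int (Poly_Mapping.lookup f \<beta>))
        (ket (shift CARD('n) (\<lambda>i. - Poly_Mapping.lookup \<beta> i) \<mu>)))"
  unfolding abs_fock_preket[symmetric]
  by (simp add: center_act_abs_fock[OF assms(1)] precenter_act_preket[OF assms(2)]
      abs_fock.sum abs_fock_scale)

definition reversal :: "nat \<Rightarrow> nat \<Rightarrow> nat" where
  "reversal r i = (if i < r then r - 1 - i else i)"

lemma reversal_permutes: "reversal r permutes {..<r}"
  by (rule bij_imp_permutes)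
    (auto simp: reversal_def intro!: bij_betwI[where g = "reversal r"])

text \<open>
  Bar reverses weights, and reversing exponents permutes the terms of a symmetric polynomial;
  so the two maps commute even before relations are imposed.
\<close>

lemma prebar_precenter_act:
  assumes f: "symmetric_in r f"
  shows "prebar n (precenter_act n r f v) = precenter_act n r f (prebar n v)"
proof (rule additive_eq_on_singles[where v = v])
  fix \<mu> c
  show "prebar n (precenter_act n r f (Poly_Mapping.single \<mu> c))
      = precenter_act n r f (prebar n (Poly_Mapping.single \<mu> c))"
  proof (cases "length \<mu> = r")
    case True
    have coeff: "bar_coeff n (shift n g \<mu>) = bar_coeff n \<mu>" for g
      by (rule bar_coeff_eqI[OF noncong_pairs_cong]) (simp_all add: list_all2_conv_all_nth nth_shift)
    have rev: "rev (shift n (\<lambda>i. - Poly_Mapping.lookup \<beta> i) \<mu>)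
        = shift n (\<lambda>i. - Poly_Mapping.lookup (permute_exponent (reversal r) \<beta>) i) (rev \<mu>)" for \<beta>
      unfolding rev_shift
      by (rule shift_cong)
        (simp add: True lookup_permute_exponent[OF permutes_inj[OF reversal_permutes]] reversal_def)
    have fr: "Poly_Mapping.lookup f (permute_exponent (reversal r) \<beta>) = Poly_Mapping.lookup f \<beta>" for \<beta>
      using f reversal_permutes by (simp add: symmetric_in_def)
    show ?thesis
      using sum_keys_symmetric[OF f reversal_permutes, of "\<lambda>\<beta>. Poly_Mapping.single
          (shift n (\<lambda>i. - Poly_Mapping.lookup \<beta> i) (rev \<mu>))
          (of_int (Poly_Mapping.lookup f \<beta>) * (laurent_conj c * bar_coeff n \<mu>))"]
      by (simp add: precenter_act_single True prebar_single prebar.sum coeff rev fr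
          laurent_conj_mult mult.assoc)
  qed (simp add: precenter_act_single_other_rank prebar_single prebar.zero)
qed (auto intro!: additive.intro simp: prebar.add precenter_act.add)

lemma bar_center_act:
  assumes "symmetric_in r f"
  shows "bar (center_act r f x) = center_act r f (bar x)"
  by (cases x rule: fock_cases)
    (simp add: center_act_abs_fock[OF assms] bar_abs_fock prebar_precenter_act[OF assms])

section \<open>The lattice spanned by the kets\<close>

lemma strict_weights_length: "\<mu> \<in> strict_weights r \<Longrightarrow> length \<mu> = r"
  by (simp add: strict_weights_def)

lemma lattice_minusE:
  assumes "x \<in> lattice_minus r"
  obtains A c where "x = (\<Sum>\<mu>\<in>A. scale (c \<mu>) (ket \<mu>))" "finite A" "A \<subseteq> strict_weights r"
    "\<And>\<mu>. \<mu> \<in> A \<Longrightarrow> c \<mu> \<in> poly_in_qinv"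
  using assms unfolding lattice_minus_def by blast

lemma lattice_minusI:
  assumes "finite A" "A \<subseteq> strict_weights r" "\<And>\<mu>. \<mu> \<in> A \<Longrightarrow> c \<mu> \<in> poly_in_qinv"
  shows "(\<Sum>\<mu>\<in>A. scale (c \<mu>) (ket \<mu>)) \<in> lattice_minus r"
  using assms unfolding lattice_minus_def by blast

lemma lattice_minus_0 [simp]: "0 \<in> lattice_minus r"
  using lattice_minusI[of "{}" r] by simp

lemma lattice_minus_strict_ket: "\<mu> \<in> strict_weights r \<Longrightarrow> ket \<mu> \<in> lattice_minus r"
  using lattice_minusI[of "{\<mu>}" r "\<lambda>_. 1"] by simp

lemma lattice_minus_scale:
  assumes "x \<in> lattice_minus r" "d \<in> poly_in_qinv"
  shows "scale d x \<in> lattice_minus r"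
proof -
  obtain A c where A: "x = (\<Sum>\<mu>\<in>A. scale (c \<mu>) (ket \<mu>))" "finite A" "A \<subseteq> strict_weights r"
    "\<And>\<mu>. \<mu> \<in> A \<Longrightarrow> c \<mu> \<in> poly_in_qinv"
    using lattice_minusE[OF assms(1)] by metis
  have "scale d x = (\<Sum>\<mu>\<in>A. scale (d * c \<mu>) (ket \<mu>))"
    by (simp add: A(1) fock.scale_sum_right)
  also have "\<dots> \<in> lattice_minus r"
    using A assms(2) by (intro lattice_minusI) (auto intro: poly_in_qinv_mult)
  finally show ?thesis .
qed

lemma lattice_minus_add:
  assumes "x \<in> lattice_minus r" "y \<in> lattice_minus r"
  shows "x + y \<in> lattice_minus r"
proof -
  obtain A c where A: "x = (\<Sum>\<mu>\<in>A. scale (c \<mu>) (ket \<mu>))" "finite A" "A \<subseteq> strict_weights r"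
    "\<And>\<mu>. \<mu> \<in> A \<Longrightarrow> c \<mu> \<in> poly_in_qinv"
    using lattice_minusE[OF assms(1)] by metis
  obtain B d where B: "y = (\<Sum>\<mu>\<in>B. scale (d \<mu>) (ket \<mu>))" "finite B" "B \<subseteq> strict_weights r"
    "\<And>\<mu>. \<mu> \<in> B \<Longrightarrow> d \<mu> \<in> poly_in_qinv"
    using lattice_minusE[OF assms(2)] by metis
  have "x = (\<Sum>\<mu>\<in>A \<union> B. scale (if \<mu> \<in> A then c \<mu> else 0) (ket \<mu>))"
    unfolding A(1) using A(2) B(2) by (intro sum.mono_neutral_cong_left) auto
  moreover have "y = (\<Sum>\<mu>\<in>A \<union> B. scale (if \<mu> \<in> B then d \<mu> else 0) (ket \<mu>))"
    unfolding B(1) using A(2) B(2) by (intro sum.mono_neutral_cong_left) auto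
  ultimately have "x + y = (\<Sum>\<mu>\<in>A \<union> B.
      scale ((if \<mu> \<in> A then c \<mu> else 0) + (if \<mu> \<in> B then d \<mu> else 0)) (ket \<mu>))"
    by (simp only: sum.distrib fock.scale_left_distrib)
  also have "\<dots> \<in> lattice_minus r"
    using A B by (intro lattice_minusI) (auto intro!: poly_in_qinv_add)
  finally show ?thesis .
qed

lemma lattice_minus_uminus: "x \<in> lattice_minus r \<Longrightarrow> - x \<in> lattice_minus r"
  using lattice_minus_scale[of x r "- 1"] poly_in_qinv_uminus[OF poly_in_qinv_1]
  by simp

lemma lattice_minus_diff:
  "x \<in> lattice_minus r \<Longrightarrow> y \<in> lattice_minus r \<Longrightarrow> x - y \<in> lattice_minus r"
  using lattice_minus_add[OF _ lattice_minus_uminus] by fastforce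

lemma lattice_minus_sum: "(\<And>i. i \<in> I \<Longrightarrow> f i \<in> lattice_minus r) \<Longrightarrow> sum f I \<in> lattice_minus r"
  by (induction I rule: infinite_finite_induct) (auto intro: lattice_minus_add)

lemma lattice_minus_subset_fock_space: "lattice_minus r \<subseteq> fock_space r"
proof
  fix x :: "'n fock" assume "x \<in> lattice_minus r"
  then obtain A c where A: "x = (\<Sum>\<mu>\<in>A. scale (c \<mu>) (ket \<mu>))" "A \<subseteq> strict_weights r"
    using lattice_minusE by metis
  show "x \<in> fock_space r"
    unfolding A fock_space_def
    by (intro fock.span_sum fock.span_scale fock.span_base)
      (use A(2) strict_weights_length in auto)
qed

section \<open>Straightening\<close>

lemma ket_equal: "(ket (xs @ [a, a] @ ys) :: 'n fock) = 0"
  unfolding abs_fock_preket[symmetric] abs_fock_relation[symmetric]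
  by (intro prefock.span_base relators.equal)

lemma ket_congruent:
  assumes "int CARD('n) dvd b - a"
  shows "(ket (xs @ [a, b] @ ys) :: 'n fock) = - ket (xs @ [b, a] @ ys)"
  using relation_congruent[OF assms, of xs ys]
  unfolding abs_fock_relation abs_fock_add abs_fock_preket by (rule eq_neg_iff_add_eq_0[THEN iffD2])

lemma ket_short:
  assumes "a < b" "b < a + int CARD('n)"
  shows "(ket (xs @ [a, b] @ ys) :: 'n fock) = - scale (qpow (- 1)) (ket (xs @ [b, a] @ ys))"
  using prefock.span_base[OF relators.k_zero[of a b "b - a" "CARD('n)" xs ys]] assms
  unfolding abs_fock_relation abs_fock_add abs_fock_scale abs_fock_preket
  by (simp add: eq_neg_iff_add_eq_0)

lemma ket_symmetrized:
  assumes "x < y" "y < x + int CARD('n)"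
  shows "(ket (xs @ [x + int CARD('n) * m, y + int CARD('n) * m'] @ ys) :: 'n fock)
     + ket (xs @ [x + int CARD('n) * m', y + int CARD('n) * m] @ ys)
    = - scale (qpow (- 1)) (ket (xs @ [y + int CARD('n) * m', x + int CARD('n) * m] @ ys)
        + ket (xs @ [y + int CARD('n) * m, x + int CARD('n) * m'] @ ys))"
  using relation_symmetrized[OF assms, of xs m m' ys]
  unfolding abs_fock_relation abs_fock_add abs_fock_scale abs_fock_preket
    eq_neg_iff_add_eq_0 fock.scale_right_distrib
  by (simp only: add.assoc)

text \<open>
  The sum of \<open>i * x\<^sub>i\<close> over the positions \<open>i\<close>, counted from 0; it decreases when a weight is straightened.
\<close>

fun moment :: "int list \<Rightarrow> int" where
  "moment [] = 0"
| "moment (x # xs) = sum_list xs + moment xs"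

lemma moment_append: "moment (xs @ ys) = moment xs + int (length xs) * sum_list ys + moment ys"
  by (induction xs) (simp_all add: algebra_simps)

lemma moment_nonneg: "(\<And>x. x \<in> set xs \<Longrightarrow> 0 \<le> x) \<Longrightarrow> 0 \<le> moment xs"
  by (induction xs) (auto intro!: add_nonneg_nonneg sum_list_nonneg)

lemma not_strict_weight_split:
  assumes "length \<mu> = r" "\<mu> \<notin> strict_weights r"
  obtains xs a b ys where "\<mu> = xs @ [a, b] @ ys" "a \<le> b"
proof -
  have "\<not> sorted_wrt (>) \<mu>"
    using assms by (simp add: strict_weights_def)
  then obtain i where i: "Suc i < length \<mu>" "\<mu> ! i \<le> \<mu> ! Suc i"
    unfolding sorted_wrt_iff_nth_Suc_transp[OF transp_on_greater] by (auto simp: not_less)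
  then have "\<mu> = take i \<mu> @ [\<mu> ! i, \<mu> ! Suc i] @ drop (Suc (Suc i)) \<mu>"
    by (simp add: Cons_nth_drop_Suc)
  with that i(2) show thesis by blast
qed

text \<open>
  No straightening rule involves a positive power of \<open>q\<close>. Straightening terminates because every rule
  replaces adjacent entries \<open>a < b\<close> by two entries that are at least \<open>a\<close>, have the same sum, and
  have the second one smaller than \<open>b\<close>; this lowers the moment by the decrease of the second entry,
  while the entries remain bounded below.
\<close>

lemma ket_in_lattice:
  assumes n: "0 < CARD('n)" and "length \<mu> = r"
  shows "(ket \<mu> :: 'n fock) \<in> lattice_minus r"
proof -
  \<comment> \<open>a lower bound of the entries; 0 is inserted for the empty weight\<close>
  define N where "N = Min (insert 0 (set \<mu>))"
  have "\<forall>x\<in>set \<mu>. N \<le> x" by (simp add: N_def)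
  then show ?thesis
    using assms(2)
  proof (induction "nat (moment (map (\<lambda>x. x - N) \<mu>))" arbitrary: \<mu> rule: less_induct)
    case (less \<mu>)
    show ?case
    proof (cases "\<mu> \<in> strict_weights r")
      case True
      then show ?thesis by (rule lattice_minus_strict_ket)
    next
      case False
      then obtain xs a b ys where \<mu>: "\<mu> = xs @ [a, b] @ ys" and "a \<le> b"
        using not_strict_weight_split less.prems(2) by metis
      have swap: "(ket (xs @ [a', b'] @ ys) :: 'n fock) \<in> lattice_minus r"
        if "a' + b' = a + b" "b' < b" "N \<le> a'" "N \<le> b'" for a' b'
      proof (rule less.hyps)
        let ?m = "\<lambda>a b. moment (map (\<lambda>x. x - N) (xs @ [a, b] @ ys))"
        have "?m a' b' - ?m a b = b' - b"
          using that(1) by (simp add: moment_append)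
        moreover have "0 \<le> ?m a' b'"
          by (rule moment_nonneg) (use less.prems(1) that in \<open>auto simp: \<mu>\<close>)
        ultimately show "nat (?m a' b') < nat (moment (map (\<lambda>x. x - N) \<mu>))"
          using that(2) unfolding \<mu> by linarith
      qed (use less.prems that in \<open>auto simp: \<mu>\<close>)
      let ?n = "int CARD('n)"
      define k where "k = (b - a) div ?n"
      define j where "j = (b - a) mod ?n"
      have b: "b = a + k * ?n + j" by (simp add: k_def j_def)
      have Na: "N \<le> a" using less.prems(1) by (simp add: \<mu>)
      have j: "0 \<le> j" "j < ?n" using n by (simp_all add: j_def)
      have k: "0 \<le> k" using n \<open>a \<le> b\<close> by (simp add: k_def pos_imp_zdiv_nonneg_iff)
      have t: "qpow (- 1) \<in> poly_in_qinv" by (simp add: poly_in_qinv_qpow)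
      consider "a = b" | "a < b" "j = 0" | "j > 0" "k = 0" | "j > 0" "k > 0"
        using j k \<open>a \<le> b\<close> by linarith
      then show ?thesis
      proof cases
        case 1
        then show ?thesis by (simp only: \<mu> ket_equal lattice_minus_0)
      next
        case 2
        have "(ket \<mu> :: 'n fock) = - ket (xs @ [b, a] @ ys)"
          unfolding \<mu> by (rule ket_congruent) (simp add: b 2)
        then show ?thesis
          using swap[of b a] 2 Na by (simp add: lattice_minus_uminus)
      next
        case 3
        then have "(ket \<mu> :: 'n fock) = - scale (qpow (- 1)) (ket (xs @ [b, a] @ ys))"
          unfolding \<mu> using j by (intro ket_short) (simp_all add: b)
        then show ?thesis
          using swap[of b a] 3 Na b t by (simp add: lattice_minus_uminus lattice_minus_scale)
      next
        case 4
        have kn: "?n \<le> k * ?n" using 4 n by simp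
        have "(ket \<mu> :: 'n fock) = - scale (qpow (- 1)) (ket (xs @ [b, a] @ ys)
              + ket (xs @ [a + j, a + k * ?n] @ ys)) - ket (xs @ [a + k * ?n, a + j] @ ys)"
          using ket_symmetrized[where 'n = 'n and x = a and y = "a + j" and m = 0 and m' = k
              and xs = xs and ys = ys] j 4 unfolding \<mu> b
          by (simp add: algebra_simps eq_diff_eq)
        moreover have "(ket (xs @ [b, a] @ ys) :: 'n fock) \<in> lattice_minus r"
          by (rule swap; use b 4 Na j kn in linarith)
        moreover have "(ket (xs @ [a + j, a + k * ?n] @ ys) :: 'n fock) \<in> lattice_minus r"
          by (rule swap; use b 4 Na j kn in linarith)
        moreover have "(ket (xs @ [a + k * ?n, a + j] @ ys) :: 'n fock) \<in> lattice_minus r"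
          by (rule swap; use b 4 Na j kn in linarith)
        ultimately show ?thesis
          using t by (auto intro!: lattice_minus_diff lattice_minus_uminus lattice_minus_scale lattice_minus_add)
      qed
    qed
  qed
qed

section \<open>Linear independence of the strict kets\<close>

text \<open>
  The sign of the permutation that sorts the list decreasingly, and 0 if an entry is repeated.
\<close>

fun sorting_sign :: "int list \<Rightarrow> int" where
  "sorting_sign [] = 1"
| "sorting_sign (x # xs) = prod_list (map (\<lambda>y. sgn (x - y)) xs) * sorting_sign xs"

lemma sorting_sign_swap: "sorting_sign (xs @ [b, a] @ ys) = - sorting_sign (xs @ [a, b] @ ys)"
proof (induction xs)
  case Nil
  have "sgn (b - a) = - sgn (a - b)" by (simp add: sgn_if)
  then show ?case by simp
next
  case (Cons x xs)
  then show ?case by simp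
qed

lemma sorting_sign_strict: "sorted_wrt (>) \<mu> \<Longrightarrow> sorting_sign \<mu> = 1"
proof (induction \<mu>)
  case (Cons x \<mu>)
  then have "\<forall>y\<in>set \<mu>. y < x" by simp
  then have "prod_list (map (\<lambda>y. sgn (x - y)) \<mu>) = 1"
    by (induction \<mu>) auto
  with Cons show ?case by simp
qed simp

text \<open>
  A coordinate of the image in the exterior power, which is the Fock space at \<open>q = 1\<close>. The coefficients
  are not specialized, so that the relations are annihilated only modulo \<open>1 - q\<^sup>-\<^sup>1\<close>.
\<close>

definition antisym_coord :: "int list \<Rightarrow> prefock \<Rightarrow> laurent" where
  "antisym_coord \<nu> = extend (\<lambda>\<mu> c. if mset \<mu> = mset \<nu> then of_int (sorting_sign \<mu>) * c else 0)"

interpretation antisym_coord: additive "antisym_coord \<nu>"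
  unfolding antisym_coord_def
  by (rule additive_extend, rule additive.intro) (simp add: distrib_left)

lemma antisym_coord_single:
  "antisym_coord \<nu> (Poly_Mapping.single \<mu> c)
    = (if mset \<mu> = mset \<nu> then of_int (sorting_sign \<mu>) * c else 0)"
  unfolding antisym_coord_def by (subst extend_single) simp_all

lemma antisym_coord_scale: "antisym_coord \<nu> (prescale c v) = c * antisym_coord \<nu> v"
  by (rule additive_eq_on_singles[where v = v])
    (auto intro!: additive.intro simp: antisym_coord.add prefock.scale_right_distrib
      distrib_left prescale_single antisym_coord_single)

lemma antisym_coord_swap:
  "antisym_coord \<nu> (preket (xs @ [b, a] @ ys)) = - antisym_coord \<nu> (preket (xs @ [a, b] @ ys))"
  using sorting_sign_swap[of xs b a ys] by (simp add: preket_def antisym_coord_single add_mset_commute)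

lemma antisym_coord_relators:
  assumes "u \<in> relators n"
  shows "(1 - qpow (- 1)) dvd antisym_coord \<nu> u"
  using assms
proof cases
  case (equal xs a ys)
  have "2 * antisym_coord \<nu> u = 0"
    using antisym_coord_swap[of \<nu> xs a a ys] unfolding equal by (simp add: eq_neg_iff_add_eq_0)
  then show ?thesis by simp
next
  case (j_zero a b k xs ys)
  show ?thesis
    unfolding j_zero(1) antisym_coord.add antisym_coord_swap[of \<nu> xs b] by simp
next
  case (k_zero a b j xs ys)
  have "antisym_coord \<nu> u = (1 - qpow (- 1)) * antisym_coord \<nu> (preket (xs @ [a, b] @ ys))"
    unfolding k_zero(1) antisym_coord.add antisym_coord_scale antisym_coord_swap[of \<nu> xs b]
    by (simp add: algebra_simps)
  then show ?thesis by simp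
next
  case (generic b a k j xs ys)
  have "antisym_coord \<nu> u = (1 - qpow (- 1)) * (antisym_coord \<nu> (preket (xs @ [a, b] @ ys))
      + antisym_coord \<nu> (preket (xs @ [a + k * int n, b - k * int n] @ ys)))"
    unfolding generic(1) antisym_coord.add antisym_coord_scale antisym_coord_swap[of \<nu> xs b]
      antisym_coord_swap[of \<nu> xs "b - k * int n"]
    by (simp add: algebra_simps)
  then show ?thesis by simp
qed

lemma antisym_coord_relation_span:
  assumes "u \<in> relation_span n"
  shows "(1 - qpow (- 1)) dvd antisym_coord \<nu> u"
  using assms
proof (induction rule: prefock.span_induct_alt)
  case base
  then show ?case by (simp add: antisym_coord.zero)
next
  case (step c x y)
  then show ?case
    by (simp add: antisym_coord.add antisym_coord_scale dvd_add dvd_mult antisym_coord_relators)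
qed

lemma relation_coefficients_divisible:
  assumes A: "finite A" "A \<subseteq> strict_weights r"
    and zero: "(\<Sum>\<mu>\<in>A. scale (c \<mu>) (ket \<mu> :: 'n fock)) = 0" and \<nu>: "\<nu> \<in> A"
  shows "(1 - qpow (- 1)) dvd c \<nu>"
proof -
  have "(abs_fock (\<Sum>\<mu>\<in>A. Poly_Mapping.single \<mu> (c \<mu>)) :: 'n fock) = 0"
    using zero by (simp add: abs_fock.sum abs_fock_single)
  then have "(1 - qpow (- 1)) dvd antisym_coord \<nu> (\<Sum>\<mu>\<in>A. Poly_Mapping.single \<mu> (c \<mu>))"
    unfolding abs_fock_relation[symmetric] by (rule antisym_coord_relation_span)
  also have "antisym_coord \<nu> (\<Sum>\<mu>\<in>A. Poly_Mapping.single \<mu> (c \<mu>))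
      = (\<Sum>\<mu>\<in>A. if \<mu> = \<nu> then c \<mu> else 0)"
    unfolding antisym_coord.sum antisym_coord_single
  proof (rule sum.cong[OF refl])
    fix \<mu> assume "\<mu> \<in> A"
    then have s: "sorted_wrt (>) \<mu>" "sorted_wrt (>) \<nu>"
      using A(2) \<nu> by (auto simp: strict_weights_def)
    have "mset \<mu> = mset \<nu> \<longleftrightarrow> \<mu> = \<nu>"
      using strict_sorted_equal[of "rev \<mu>" "rev \<nu>"] s mset_eq_setD[of \<mu> \<nu>]
      by (auto simp: sorted_wrt_rev)
    then show "(if mset \<mu> = mset \<nu> then of_int (sorting_sign \<mu>) * c \<mu> else 0)
        = (if \<mu> = \<nu> then c \<mu> else 0)"
      using sorting_sign_strict[OF s(1)] by auto
  qed
  also have "\<dots> = c \<nu>" using A(1) \<nu> by simp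
  finally show ?thesis .
qed

text \<open>
  The Fock space of rank \<open>r\<close> is free on the canonical basis.
\<close>

lemma canonical_basis_torsion_free:
  fixes G :: "int list \<Rightarrow> 'n fock" and x :: "'n fock"
  assumes G: "is_canonical_basis r G" and x: "x \<in> fock_space r"
    and c: "c \<noteq> 0" and cx: "scale c x = 0"
  shows "x = 0"
proof -
  have ind: "fock.independent (G ` strict_weights r)"
    and span: "x \<in> fock.span (G ` strict_weights r)"
    using G x by (auto simp: is_canonical_basis_def)
  obtain T u where T: "finite T" "T \<subseteq> G ` strict_weights r" "x = (\<Sum>v\<in>T. scale (u v) v)"
    using span unfolding fock.span_explicit by blast
  have "(\<Sum>v\<in>T. scale (c * u v) v) = 0"
    using cx unfolding T(3) by (simp add: fock.scale_sum_right)
  then have "c * u v = 0" if "v \<in> T" for v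
    using fock.independentD[OF ind T(1,2), of "\<lambda>v. c * u v"] that by simp
  then show ?thesis
    using c by (simp add: T(3))
qed

text \<open>
  The coefficients of a relation between strict kets are divisible by \<open>1 - q\<^sup>-\<^sup>1\<close>, and the
  quotients are the coefficients of another relation because there is no torsion. Repeating this shrinks
  the interval that contains all exponents until it is empty.
\<close>

lemma strict_kets_independent:
  fixes G :: "int list \<Rightarrow> 'n fock"
  assumes G: "is_canonical_basis r G" and A: "finite A" "A \<subseteq> strict_weights r"
    and zero: "(\<Sum>\<mu>\<in>A. scale (c \<mu>) (ket \<mu> :: 'n fock)) = 0" and "\<nu> \<in> A"
  shows "c \<nu> = 0"
proof -
  have descent: "\<forall>\<mu>\<in>A. c \<mu> = 0"
    if "\<forall>\<mu>\<in>A. Poly_Mapping.keys (c \<mu>) \<subseteq> {a..b}" "(\<Sum>\<mu>\<in>A. scale (c \<mu>) (ket \<mu> :: 'n fock)) = 0"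
    for a b c
    using that
  proof (induction "nat (b - a + 1)" arbitrary: a c rule: less_induct)
    case less
    show ?case
    proof (cases "a \<le> b")
      case False
      then show ?thesis using less.prems(1) by simp
    next
      case True
      have "\<forall>\<mu>\<in>A. \<exists>d. c \<mu> = (1 - qpow (- 1)) * d"
        using relation_coefficients_divisible[OF A less.prems(2)] by (auto elim: dvdE)
      then obtain d where d: "\<And>\<mu>. \<mu> \<in> A \<Longrightarrow> c \<mu> = (1 - qpow (- 1)) * d \<mu>" by metis
      have "scale (1 - qpow (- 1)) (\<Sum>\<mu>\<in>A. scale (d \<mu>) (ket \<mu> :: 'n fock)) = 0"
        using less.prems(2) by (simp add: fock.scale_sum_right d cong: sum.cong)
      moreover have "(\<Sum>\<mu>\<in>A. scale (d \<mu>) (ket \<mu> :: 'n fock)) \<in> fock_space r"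
        unfolding fock_space_def
        by (intro fock.span_sum fock.span_scale fock.span_base)
          (use A(2) strict_weights_length in auto)
      moreover have "Poly_Mapping.lookup (1 - qpow (- 1)) 0 = 1"
        by (simp add: lookup_minus qpow_def lookup_single)
      then have "1 - qpow (- 1) \<noteq> 0" by auto
      ultimately have "(\<Sum>\<mu>\<in>A. scale (d \<mu>) (ket \<mu> :: 'n fock)) = 0"
        using canonical_basis_torsion_free[OF G] by blast
      moreover have "\<forall>\<mu>\<in>A. Poly_Mapping.keys (d \<mu>) \<subseteq> {a + 1..b}"
        using less.prems(1) d by (intro ballI keys_div_one_minus_qinv) simp
      ultimately have "\<forall>\<mu>\<in>A. d \<mu> = 0"
        using True by (intro less.hyps[of "a + 1" d]) auto
      then show ?thesis using d by simp
    qed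
  qed
  let ?K = "\<Union>\<mu>\<in>A. Poly_Mapping.keys (c \<mu>)"
  have "finite ?K" using A(1) by simp
  then have "\<forall>\<mu>\<in>A. Poly_Mapping.keys (c \<mu>) \<subseteq> {Min ?K..Max ?K}"
    by (intro ballI subsetI) (simp only: atLeastAtMost_iff, blast intro: Min_le Max_ge)
  from descent[OF this zero] show ?thesis using \<open>\<nu> \<in> A\<close> by blast
qed

section \<open>Bar-invariant vectors in the lattice\<close>

abbreviation qinv_lattice :: "nat \<Rightarrow> 'n fock set" where
  "qinv_lattice r \<equiv> scale (qpow (- 1)) ` lattice_minus r"

lemma qinv_latticeI: "x \<in> lattice_minus r \<Longrightarrow> scale (qpow (- 1)) x \<in> qinv_lattice r"
  by (rule imageI)

lemma qinv_lattice_add: "x \<in> qinv_lattice r \<Longrightarrow> y \<in> qinv_lattice r \<Longrightarrow> x + y \<in> qinv_lattice r"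
  by (auto simp: lattice_minus_add simp flip: fock.scale_right_distrib)

lemma qinv_lattice_scale:
  assumes "x \<in> qinv_lattice r" "c \<in> poly_in_qinv"
  shows "scale c x \<in> qinv_lattice r"
proof -
  obtain y where "y \<in> lattice_minus r" "x = scale (qpow (- 1)) y"
    using assms(1) by blast
  then have "scale c x = scale (qpow (- 1)) (scale c y)" "scale c y \<in> lattice_minus r"
    by (simp_all add: mult.commute lattice_minus_scale assms(2))
  then show ?thesis by (simp only: qinv_latticeI)
qed

lemma qinv_lattice_uminus: "x \<in> qinv_lattice r \<Longrightarrow> - x \<in> qinv_lattice r"
  using qinv_lattice_scale[of x r "- 1"] poly_in_qinv_uminus[OF poly_in_qinv_1] by simp

lemma qinv_lattice_diff: "x \<in> qinv_lattice r \<Longrightarrow> y \<in> qinv_lattice r \<Longrightarrow> x - y \<in> qinv_lattice r"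
  using qinv_lattice_add[OF _ qinv_lattice_uminus] by fastforce

lemma qinv_lattice_0: "0 \<in> qinv_lattice r"
  using qinv_latticeI[OF lattice_minus_0] by simp

lemma qinv_lattice_sum: "(\<And>i. i \<in> I \<Longrightarrow> f i \<in> qinv_lattice r) \<Longrightarrow> sum f I \<in> qinv_lattice r"
  by (induction I rule: infinite_finite_induct) (simp_all add: qinv_lattice_0 qinv_lattice_add)

lemma qinv_lattice_subset_fock_space: "qinv_lattice r \<subseteq> fock_space r"
  using lattice_minus_subset_fock_space[of r] unfolding fock_space_def
  by (auto intro: fock.span_scale)

lemma kets_independent_mod_qinv:
  fixes G :: "int list \<Rightarrow> 'n fock"
  assumes G: "is_canonical_basis r G" and A: "finite A" "A \<subseteq> strict_weights r"
    and mem: "(\<Sum>\<mu>\<in>A. scale (c \<mu>) (ket \<mu> :: 'n fock)) \<in> qinv_lattice r" and \<nu>: "\<nu> \<in> A"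
  shows "Poly_Mapping.lookup (c \<nu>) 0 = 0"
proof -
  obtain y where y: "y \<in> lattice_minus r" "(\<Sum>\<mu>\<in>A. scale (c \<mu>) (ket \<mu> :: 'n fock)) = scale (qpow (- 1)) y"
    using mem by blast
  obtain B e where B: "y = (\<Sum>\<mu>\<in>B. scale (e \<mu>) (ket \<mu>))" "finite B" "B \<subseteq> strict_weights r"
    "\<And>\<mu>. \<mu> \<in> B \<Longrightarrow> e \<mu> \<in> poly_in_qinv"
    using lattice_minusE[OF y(1)] by metis
  have "(\<Sum>\<mu>\<in>A. scale (c \<mu>) (ket \<mu> :: 'n fock))
      = (\<Sum>\<mu>\<in>A \<union> B. scale (if \<mu> \<in> A then c \<mu> else 0) (ket \<mu>))"
    using A(1) B(2) by (intro sum.mono_neutral_cong_left) auto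
  moreover have "scale (qpow (- 1)) y
      = (\<Sum>\<mu>\<in>A \<union> B. scale (if \<mu> \<in> B then qpow (- 1) * e \<mu> else 0) (ket \<mu>))"
    unfolding B(1) fock.scale_sum_right using A(1) B(2) by (intro sum.mono_neutral_cong_left) auto
  ultimately have "(\<Sum>\<mu>\<in>A \<union> B. scale ((if \<mu> \<in> A then c \<mu> else 0)
      - (if \<mu> \<in> B then qpow (- 1) * e \<mu> else 0)) (ket \<mu> :: 'n fock)) = 0"
    using y(2) by (simp only: fock.scale_left_diff_distrib sum_subtractf) simp
  from strict_kets_independent[OF G _ _ this, of \<nu>]
  have "c \<nu> = (if \<nu> \<in> B then qpow (- 1) * e \<nu> else 0)"
    using A B(2,3) \<nu> by auto
  then show ?thesis
    using B(4)[of \<nu>] by (simp add: lookup_qpow_mult poly_in_qinv_iff)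
qed

text \<open>
  The coefficients of such a vector in the canonical basis are invariant under conjugation. If they
  are not all zero, the largest exponent \<open>D\<close> that occurs in them is nonnegative, and after
  multiplication with \<open>q\<close> to the power \<open>- D\<close> the vector still lies in \<open>q\<^sup>-\<^sup>1 L\<close>. But then its
  coefficients in the canonical basis are polynomials in \<open>q\<^sup>-\<^sup>1\<close> whose constant terms are not all zero,
  and modulo \<open>q\<^sup>-\<^sup>1 L\<close> the canonical basis vectors agree with the strict kets, which are independent there.
\<close>

lemma bar_invariant_in_qinv_lattice:
  fixes G :: "int list \<Rightarrow> 'n fock" and x :: "'n fock"
  assumes G: "is_canonical_basis r G" and x: "x \<in> qinv_lattice r" and bar: "bar x = x"
  shows "x = 0"
proof -
  have ind: "fock.independent (G ` strict_weights r)" and inj: "inj_on G (strict_weights r)"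
    and barG: "\<And>\<mu>. \<mu> \<in> strict_weights r \<Longrightarrow> bar (G \<mu>) = G \<mu>"
    and Gket: "\<And>\<mu>. \<mu> \<in> strict_weights r \<Longrightarrow> G \<mu> - ket \<mu> \<in> qinv_lattice r"
    using G by (auto simp: is_canonical_basis_def)
  have "x \<in> fock.span (G ` strict_weights r)"
    using G qinv_lattice_subset_fock_space x unfolding is_canonical_basis_def by blast
  then obtain T u where T: "finite T" "T \<subseteq> G ` strict_weights r" "x = (\<Sum>v\<in>T. scale (u v) v)"
    unfolding fock.span_explicit by blast
  obtain A where A: "A \<subseteq> strict_weights r" "finite A" "T = G ` A"
    using finite_subset_image[OF T(1,2)] by blast
  have injA: "inj_on G A" using inj A(1) by (rule inj_on_subset)
  have conj: "laurent_conj (u v) = u v" if "v \<in> T" for v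
  proof -
    have "bar x = (\<Sum>v\<in>T. scale (laurent_conj (u v)) v)"
      unfolding T(3) bar.sum bar_scale using T(2) barG by (intro sum.cong) auto
    with bar have "(\<Sum>v\<in>T. scale (laurent_conj (u v) - u v) v) = 0"
      by (simp add: fock.scale_left_diff_distrib sum_subtractf T(3))
    from fock.independentD[OF ind T(1,2) this that] show ?thesis by simp
  qed
  let ?K = "\<Union>v\<in>T. Poly_Mapping.keys (u v)"
  have finK: "finite ?K" using T(1) by simp
  have "?K = {}"
  proof (rule ccontr)
    assume "?K \<noteq> {}"
    define D where "D = Max ?K"
    have "D \<in> ?K" unfolding D_def using finK \<open>?K \<noteq> {}\<close> by (rule Max_in)
    then obtain w where w: "w \<in> T" "D \<in> Poly_Mapping.keys (u w)" by blast
    have le: "k \<le> D" if "v \<in> T" "k \<in> Poly_Mapping.keys (u v)" for v k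
      unfolding D_def using finK that by (intro Max_ge) auto
    have "- D \<in> Poly_Mapping.keys (u w)"
      using w conj[OF w(1)] lookup_laurent_conj[of "u w" D] by (simp add: in_keys_iff)
    with le w(1) have "0 \<le> D" by fastforce
    have poly: "qpow (- D) * u v \<in> poly_in_qinv" if "v \<in> T" for v
      unfolding poly_in_qinv_iff lookup_qpow_mult
    proof (intro allI impI)
      fix k :: int assume "0 < k"
      then have "k - - D \<notin> Poly_Mapping.keys (u v)" using le[OF that] by fastforce
      then show "Poly_Mapping.lookup (u v) (k - - D) = 0" by (simp only: in_keys_iff not_not)
    qed
    have "(\<Sum>\<mu>\<in>A. scale (qpow (- D) * u (G \<mu>)) (ket \<mu> :: 'n fock))
        = scale (qpow (- D)) x - (\<Sum>\<mu>\<in>A. scale (qpow (- D) * u (G \<mu>)) (G \<mu> - ket \<mu>))"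
      unfolding T(3) A(3) sum.reindex[OF injA]
      by (simp add: fock.scale_sum_right fock.scale_right_diff_distrib sum_subtractf)
    also have "\<dots> \<in> qinv_lattice r"
      using A x \<open>0 \<le> D\<close> by (intro qinv_lattice_diff qinv_lattice_sum qinv_lattice_scale Gket poly)
        (auto intro: poly_in_qinv_qpow)
    finally have mem: "(\<Sum>\<mu>\<in>A. scale (qpow (- D) * u (G \<mu>)) (ket \<mu> :: 'n fock)) \<in> qinv_lattice r" .
    obtain \<nu> where "\<nu> \<in> A" "w = G \<nu>" using w(1) A(3) by blast
    with kets_independent_mod_qinv[OF G A(2,1) mem, of \<nu>] w(2) show False
      by (simp add: lookup_qpow_mult in_keys_iff)
  qed
  then have "u v = 0" if "v \<in> T" for v
    using that by simp
  then show ?thesis by (simp add: T(3))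
qed

section \<open>Schur polynomials as quotients of alternants\<close>

definition exponent :: "nat \<Rightarrow> int list \<Rightarrow> (nat \<Rightarrow> nat) \<Rightarrow> (nat \<Rightarrow>\<^sub>0 int)" where
  "exponent r \<alpha> \<pi> = (\<Sum>i<r. Poly_Mapping.single i (\<alpha> ! \<pi> i))"

lemma lookup_exponent:
  "Poly_Mapping.lookup (exponent r \<alpha> \<pi>) i = (if i < r then \<alpha> ! \<pi> i else 0)"
  by (simp add: exponent_def lookup_sum lookup_single when_def if_distrib cong: if_cong)

lemma of_int_mult_single:
  "(of_int z :: mlaurent) * Poly_Mapping.single \<gamma> c = Poly_Mapping.single \<gamma> (z * c)"
proof -
  have "of_int z = (Poly_Mapping.single 0 z :: mlaurent)"
    by (rule poly_mapping_eqI) (simp add: lookup_of_int lookup_single)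
  then show ?thesis by (simp add: mult_single)
qed

lemma alternant_eq_exponents:
  "alternant r \<alpha> = (\<Sum>\<pi> | \<pi> permutes {..<r}. Poly_Mapping.single (exponent r \<alpha> \<pi>) (sign \<pi>))"
  by (simp add: alternant_def exponent_def of_int_mult_single)

lemma single_sum_eq_prod:
  "finite I \<Longrightarrow> Poly_Mapping.single (\<Sum>i\<in>I. e i) (1 :: int) = (\<Prod>i\<in>I. Poly_Mapping.single (e i) 1)"
proof (induction I rule: finite_induct)
  case (insert i I)
  have "Poly_Mapping.single (e i + sum e I) (1 :: int)
      = Poly_Mapping.single (e i) 1 * Poly_Mapping.single (sum e I) 1"
    by (simp add: mult_single)
  with insert show ?case by simp
qed simp

definition var :: "nat \<Rightarrow> mlaurent" where
  "var i = Poly_Mapping.single (Poly_Mapping.single i 1) 1"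

lemma var_power: "var i ^ m = Poly_Mapping.single (Poly_Mapping.single i (int m)) 1"
proof (induction m)
  case (Suc m)
  then show ?case
    by (simp add: var_def mult_single single_add[symmetric] add.commute)
qed simp

lemma alternant_eq_det:
  assumes "\<And>j. j < r \<Longrightarrow> 0 \<le> \<alpha> ! j"
  shows "alternant r \<alpha> = det (mat r r (\<lambda>(i, j). var i ^ nat (\<alpha> ! j)))"
proof -
  have "Poly_Mapping.single (\<Sum>i<r. Poly_Mapping.single i (\<alpha> ! \<pi> i)) 1
      = (\<Prod>i = 0..<r. mat r r (\<lambda>(i, j). var i ^ nat (\<alpha> ! j)) $$ (i, \<pi> i))"
    if "\<pi> permutes {0..<r}" for \<pi>
  proof -
    have "\<pi> i < r" if "i < r" for i
      using permutes_in_image[OF \<open>\<pi> permutes {0..<r}\<close>, of i] that by simp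
    then show ?thesis
      using assms by (auto simp: single_sum_eq_prod var_power atLeast0LessThan intro!: prod.cong)
  qed
  then show ?thesis
    by (simp add: alternant_def det_def atLeast0LessThan)
qed

text \<open>
  All \<open>x\<^sub>i\<close> are roots of the monic polynomial \<open>\<Prod>\<^sub>j (X - x\<^sub>j)\<close> of degree \<open>r\<close>, so a power of \<open>X\<close> can be
  replaced by its remainder, whose coefficients do not depend on \<open>i\<close>.
\<close>

lemma power_eq_sum_low_powers:
  fixes x :: "nat \<Rightarrow> 'a::idom"
  assumes "0 < r"
  shows "\<exists>c. \<forall>i<r. x i ^ m = (\<Sum>k<r. c k * x i ^ k)"
proof -
  obtain s where s: "r = Suc s" using assms gr0_implies_Suc by blast
  define p where "p = (\<Prod>j<r. [:- x j, 1:])"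
  have "degree p = r"
    unfolding p_def by (subst degree_prod_eq_sum_degree) auto
  moreover have "lead_coeff p = 1"
    unfolding p_def lead_coeff_prod by simp
  moreover have "poly p (x i) = 0" if "i < r" for i
    unfolding p_def poly_prod using that by (intro prod_zero) auto
  ultimately have root: "x i ^ r = - (\<Sum>k<r. coeff p k * x i ^ k)" if "i < r" for i
    using that poly_altdef[of p "x i"]
    by (simp add: lessThan_Suc_atMost[symmetric] eq_neg_iff_add_eq_0 add.commute)
  show ?thesis
  proof (induction m)
    case 0
    have "x i ^ 0 = (\<Sum>k<r. (if k = 0 then 1 else 0) * x i ^ k)" for i
      unfolding s by (subst sum.lessThan_Suc_shift) simp
    then show ?case by (intro exI[of _ "\<lambda>k. if k = 0 then 1 else 0"]) blast
  next
    case (Suc m)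
    then obtain c where c: "\<And>i. i < r \<Longrightarrow> x i ^ m = (\<Sum>k<r. c k * x i ^ k)" by blast
    have "x i ^ Suc m = (\<Sum>k<r. ((if k = 0 then 0 else c (k - 1)) - c s * coeff p k) * x i ^ k)"
      if "i < r" for i
    proof -
      have "x i ^ Suc m = (\<Sum>k<s. c k * x i ^ Suc k) + c s * x i ^ r"
        by (simp add: c[OF that] s sum_distrib_left algebra_simps)
      also have "(\<Sum>k<s. c k * x i ^ Suc k) = (\<Sum>k<r. (if k = 0 then 0 else c (k - 1)) * x i ^ k)"
        unfolding s by (subst sum.lessThan_Suc_shift) simp
      finally show ?thesis
        by (simp only: root[OF that] mult_minus_right left_diff_distrib sum_subtractf
            sum_distrib_left mult.assoc add_uminus_conv_diff)
    qed
    then show ?case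
      by (intro exI[of _ "\<lambda>k. (if k = 0 then 0 else c (k - 1)) - c s * coeff p k"] allI impI)
  qed
qed

lemma nth_rho: "i < r \<Longrightarrow> rho r ! i = int (r - 1 - i)"
  by (simp add: rho_def)

lemma nat_nth_rho: "i < r \<Longrightarrow> nat (rho r ! i) = r - 1 - i"
  by (simp only: nth_rho nat_int)

lemma length_rho [simp]: "length (rho r) = r"
  by (simp add: rho_def)

text \<open>
  Reducing the powers in the matrix of an alternant to exponents below \<open>r\<close> factors it into the matrix of
  the \<open>\<rho>\<close>-alternant and a matrix of coefficients. The entries of \<open>\<rho>\<close> decrease, which accounts for
  the reversed index in the second factor.
\<close>

lemma alternant_rho_dvd:
  assumes r: "0 < r" and nonneg: "\<And>j. j < r \<Longrightarrow> 0 \<le> \<alpha> ! j"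
  shows "alternant r (rho r) dvd alternant r \<alpha>"
proof -
  have "\<forall>m. \<exists>c. \<forall>i<r. var i ^ m = (\<Sum>k<r. c k * var i ^ k)"
    using power_eq_sum_low_powers[OF r, of var] by blast
  then obtain c where c: "\<And>m i. i < r \<Longrightarrow> var i ^ m = (\<Sum>k<r. c m k * var i ^ k)"
    by metis
  define V where "V = mat r r (\<lambda>(i, j). var i ^ nat (rho r ! j))"
  define C where "C = mat r r (\<lambda>(k, j). c (nat (\<alpha> ! j)) (r - 1 - k))"
  have "mat r r (\<lambda>(i, j). var i ^ nat (\<alpha> ! j)) = V * C"
  proof (rule eq_matI)
    fix i j assume "i < dim_row (V * C)" "j < dim_col (V * C)"
    then have ij: "i < r" "j < r" by (simp_all add: V_def C_def)
    have "(V * C) $$ (i, j) = (\<Sum>k<r. var i ^ (r - 1 - k) * c (nat (\<alpha> ! j)) (r - 1 - k))"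
      using ij by (simp add: V_def C_def scalar_prod_def atLeast0LessThan nat_nth_rho)
    also have "\<dots> = (\<Sum>k<r. c (nat (\<alpha> ! j)) k * var i ^ k)"
      using sum.nat_diff_reindex[of "\<lambda>k. c (nat (\<alpha> ! j)) k * var i ^ k" r]
      by (simp add: mult.commute)
    also have "\<dots> = var i ^ nat (\<alpha> ! j)" by (rule c[OF ij(1), symmetric])
    finally show "mat r r (\<lambda>(i, j). var i ^ nat (\<alpha> ! j)) $$ (i, j) = (V * C) $$ (i, j)"
      using ij by simp
  qed (simp_all add: V_def C_def)
  then have "alternant r \<alpha> = det V * det C"
    by (simp add: alternant_eq_det[OF nonneg], subst det_mult[where n = r])
      (simp_all add: V_def C_def)
  moreover have "alternant r (rho r) = det V"
    unfolding V_def by (rule alternant_eq_det) (simp add: nth_rho)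
  ultimately show ?thesis by simp
qed

text \<open>
  The entries of \<open>\<rho>\<close> are distinct, so the monomial of the identity permutation occurs once.
\<close>

lemma alternant_rho_nonzero: "alternant r (rho r) \<noteq> 0"
proof -
  have "Poly_Mapping.lookup (alternant r (rho r)) (exponent r (rho r) id)
      = (\<Sum>\<pi> | \<pi> permutes {..<r}. if \<pi> = id then 1 else 0)"
    unfolding alternant_eq_exponents lookup_sum
  proof (rule sum.cong[OF refl])
    fix \<pi> assume "\<pi> \<in> {\<pi>. \<pi> permutes {..<r}}"
    then have \<pi>: "\<pi> permutes {..<r}" by simp
    have "\<pi> = id" if e: "exponent r (rho r) \<pi> = exponent r (rho r) id"
    proof
      fix i
      show "\<pi> i = id i"
      proof (cases "i < r")
        case True
        moreover have "\<pi> i < r" using permutes_in_image[OF \<pi>, of i] True by simp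
        ultimately show ?thesis
          using arg_cong[OF e, of "\<lambda>\<gamma>. Poly_Mapping.lookup \<gamma> i"]
          by (simp add: lookup_exponent nth_rho)
      qed (use \<pi> in \<open>simp add: permutes_def\<close>)
    qed
    then show "Poly_Mapping.lookup (Poly_Mapping.single (exponent r (rho r) \<pi>) (sign \<pi>)) (exponent r (rho r) id)
        = (if \<pi> = id then 1 else 0)"
      by (auto simp: lookup_single when_def)
  qed
  also have "\<dots> = 1"
    by (simp add: finite_permutations permutes_id)
  finally show ?thesis by auto
qed

lemma schur_mult_alternant:
  assumes "0 < r" "length \<kappa> = r" "\<And>j. j < r \<Longrightarrow> 0 \<le> \<kappa> ! j"
  shows "schur r \<kappa> * alternant r (rho r) = alternant r (weight_add \<kappa> (rho r))"
proof -
  have "alternant r (rho r) dvd alternant r (weight_add \<kappa> (rho r))"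
    by (rule alternant_rho_dvd[OF assms(1)]) (simp add: weight_add_def assms nth_rho)
  then obtain s where "s * alternant r (rho r) = alternant r (weight_add \<kappa> (rho r))"
    by (metis dvdE mult.commute)
  then have "\<exists>!s. s * alternant r (rho r) = alternant r (weight_add \<kappa> (rho r))"
    using alternant_rho_nonzero by (metis mult_right_cancel)
  then show ?thesis
    unfolding schur_def by (rule theI')
qed

definition permute_vars :: "(nat \<Rightarrow> nat) \<Rightarrow> mlaurent \<Rightarrow> mlaurent" where
  "permute_vars \<pi> f = Poly_Mapping.map_key (permute_exponent \<pi>) f"

lemma lookup_permute_vars:
  "\<pi> permutes S \<Longrightarrow> Poly_Mapping.lookup (permute_vars \<pi> f) \<beta> = Poly_Mapping.lookup f (permute_exponent \<pi> \<beta>)"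
  by (simp add: permute_vars_def Poly_Mapping.map_key.rep_eq bij_is_inj[OF bij_permute_exponent])

lemma additive_permute_vars: "\<pi> permutes S \<Longrightarrow> additive (permute_vars \<pi>)"
  by (auto intro!: additive.intro poly_mapping_eqI simp: lookup_permute_vars lookup_add)

lemma permute_exponent_add:
  "\<pi> permutes S \<Longrightarrow> permute_exponent \<pi> (\<beta> + \<gamma>) = permute_exponent \<pi> \<beta> + permute_exponent \<pi> \<gamma>"
  by (auto intro!: poly_mapping_eqI simp: lookup_permute_exponent lookup_add permutes_inj)

lemma permute_vars_single:
  assumes "\<pi> permutes S"
  shows "permute_vars \<pi> (Poly_Mapping.single \<gamma> c) = Poly_Mapping.single (permute_exponent (inv_into UNIV \<pi>) \<gamma>) c"
proof (rule poly_mapping_eqI)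
  note i = permutes_inj[OF assms] permutes_inj[OF permutes_inv[OF assms]]
  have "\<gamma> = permute_exponent \<pi> \<beta> \<longleftrightarrow> permute_exponent (inv_into UNIV \<pi>) \<gamma> = \<beta>" for \<beta>
    by (auto intro!: poly_mapping_eqI simp: lookup_permute_exponent i permutes_inverses[OF assms])
  then show "Poly_Mapping.lookup (permute_vars \<pi> (Poly_Mapping.single \<gamma> c)) \<beta>
      = Poly_Mapping.lookup (Poly_Mapping.single (permute_exponent (inv_into UNIV \<pi>) \<gamma>) c) \<beta>" for \<beta>
    by (simp add: lookup_permute_vars[OF assms] lookup_single when_def)
qed

lemma permute_vars_mult:
  assumes "\<pi> permutes S"
  shows "permute_vars \<pi> (f * g) = permute_vars \<pi> f * permute_vars \<pi> g"
  by (rule mult_eq_on_singles[OF additive_permute_vars[OF assms]])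
    (simp add: mult_single permute_vars_single[OF assms] permute_exponent_add[OF permutes_inv[OF assms]])

lemma permute_vars_alternant:
  assumes \<pi>: "\<pi> permutes {..<r}"
  shows "permute_vars \<pi> (alternant r \<alpha>) = of_int (sign \<pi>) * alternant r \<alpha>"
proof -
  have perm: "permutation \<pi>" "permutation \<tau>" if "\<tau> permutes {..<r}" for \<tau>
    using \<pi> that by (auto intro: permutes_imp_permutation[OF finite_lessThan])
  have "permute_exponent (inv_into UNIV \<pi>) (exponent r \<alpha> (\<tau> \<circ> \<pi>)) = exponent r \<alpha> \<tau>" for \<tau>
    using permutes_in_image[OF permutes_inv[OF \<pi>]]
    by (intro poly_mapping_eqI)
      (simp add: lookup_permute_exponent[OF permutes_inj[OF permutes_inv[OF \<pi>]]] lookup_exponent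
        permutes_inverses[OF \<pi>])
  then have "permute_vars \<pi> (alternant r \<alpha>)
      = (\<Sum>\<tau> | \<tau> permutes {..<r}. Poly_Mapping.single (exponent r \<alpha> \<tau>) (sign (\<tau> \<circ> \<pi>)))"
    unfolding alternant_eq_exponents additive.sum[OF additive_permute_vars[OF \<pi>]]
    by (subst sum_permutations_compose_right[OF \<pi>]) (simp add: permute_vars_single[OF \<pi>])
  also have "\<dots> = of_int (sign \<pi>) * alternant r \<alpha>"
    unfolding alternant_eq_exponents sum_distrib_left
    by (intro sum.cong) (simp_all add: of_int_mult_single sign_compose perm mult.commute)
  finally show ?thesis .
qed

text \<open>
  A permutation of the variables multiplies numerator and denominator by the same sign.
\<close>

lemma symmetric_schur:
  assumes "0 < r" "length \<kappa> = r" "\<And>j. j < r \<Longrightarrow> 0 \<le> \<kappa> ! j"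
  shows "symmetric_in r (schur r \<kappa>)"
  unfolding symmetric_in_def
proof (intro allI impI)
  fix \<pi> \<beta> assume \<pi>: "\<pi> permutes {..<r}"
  let ?s = "schur r \<kappa>"
  have "permute_vars \<pi> (?s * alternant r (rho r)) = permute_vars \<pi> (alternant r (weight_add \<kappa> (rho r)))"
    by (simp add: schur_mult_alternant[OF assms])
  then have "of_int (sign \<pi>) * (permute_vars \<pi> ?s * alternant r (rho r))
      = of_int (sign \<pi>) * (?s * alternant r (rho r))"
    unfolding permute_vars_mult[OF \<pi>] permute_vars_alternant[OF \<pi>]
    by (simp add: schur_mult_alternant[OF assms] mult.left_commute)
  moreover have "(of_int (sign \<pi>) :: mlaurent) \<noteq> 0" by (simp add: sign_def)
  ultimately have "permute_vars \<pi> ?s = ?s"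
    using alternant_rho_nonzero[of r] by simp
  then show "Poly_Mapping.lookup ?s (permute_exponent \<pi> \<beta>) = Poly_Mapping.lookup ?s \<beta>"
    using lookup_permute_vars[OF \<pi>, of ?s \<beta>] by simp
qed

lemma lookup_invert_vars: "Poly_Mapping.lookup (invert_vars f) \<beta> = Poly_Mapping.lookup f (- \<beta>)"
  by (simp add: invert_vars_def Poly_Mapping.map_key.rep_eq)

lemma symmetric_invert_vars:
  assumes "symmetric_in r f"
  shows "symmetric_in r (invert_vars f)"
  unfolding symmetric_in_def
proof (intro allI impI)
  fix \<pi> \<beta> assume \<pi>: "\<pi> permutes {..<r}"
  have "- permute_exponent \<pi> \<beta> = permute_exponent \<pi> (- \<beta>)"
    by (rule poly_mapping_eqI) (simp add: lookup_permute_exponent[OF permutes_inj[OF \<pi>]])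
  then show "Poly_Mapping.lookup (invert_vars f) (permute_exponent \<pi> \<beta>) = Poly_Mapping.lookup (invert_vars f) \<beta>"
    using assms \<pi> by (simp add: lookup_invert_vars symmetric_in_def)
qed

section \<open>Antisymmetry modulo the lattice\<close>

lemma adjacent_transpositions_suffice:
  fixes E :: "(nat \<Rightarrow> int) \<Rightarrow> 'n fock"
  assumes adj: "\<And>i g. Suc i < r \<Longrightarrow> E (g \<circ> Transposition.transpose i (Suc i)) + E g \<in> qinv_lattice r"
    and \<pi>: "\<pi> permutes {..<r}"
  shows "E (g \<circ> \<pi>) - scale (of_int (sign \<pi>)) (E g) \<in> qinv_lattice r"
proof -
  have transposition: "E (g \<circ> Transposition.transpose a b) + E g \<in> qinv_lattice r" if "a < b" "b < r" for a b g
    using that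
  proof (induction b arbitrary: g)
    case (Suc b)
    show ?case
    proof (cases "a = b")
      case True
      show ?thesis
        unfolding True by (rule adj) (use Suc.prems in simp)
    next
      case False
      let ?s = "Transposition.transpose b (Suc b)" and ?t = "Transposition.transpose a b"
      \<comment> \<open>conjugation by an adjacent transposition reduces the distance of the two positions\<close>
      have "Transposition.transpose a (Suc b) = ?s \<circ> ?t \<circ> ?s"
        using Suc.prems False by (auto simp: fun_eq_iff Transposition.transpose_def)
      then have "E (g \<circ> Transposition.transpose a (Suc b)) + E g
          = (E (g \<circ> ?s \<circ> ?t \<circ> ?s) + E (g \<circ> ?s \<circ> ?t)) - (E (g \<circ> ?s \<circ> ?t) + E (g \<circ> ?s))
            + (E (g \<circ> ?s) + E g)"
        by (simp add: comp_assoc)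
      also have "\<dots> \<in> qinv_lattice r"
        using False Suc.prems
        by (intro qinv_lattice_add qinv_lattice_diff adj Suc.IH) auto
      finally show ?thesis .
    qed
  qed simp
  show ?thesis
    using finite_lessThan \<pi>
  proof (induction \<pi> arbitrary: g rule: permutes_rev_induct)
    case id
    show ?case by (simp add: qinv_lattice_0)
  next
    case (swap a b \<pi>)
    let ?t = "Transposition.transpose a b"
    have "E (g \<circ> \<pi> \<circ> ?t) + E (g \<circ> \<pi>) \<in> qinv_lattice r"
      using transposition[of a b] transposition[of b a] swap.hyps(1-3)
      by (cases "a < b") (auto simp: transpose_commute)
    moreover have "sign (\<pi> \<circ> ?t) = - sign \<pi>"
      using swap.hyps permutes_imp_permutation[OF finite_lessThan swap.hyps(4)]
      by (simp add: sign_compose sign_swap_id permutation_swap_id)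
    then have "E (g \<circ> (\<pi> \<circ> ?t)) - scale (of_int (sign (\<pi> \<circ> ?t))) (E g)
        = (E (g \<circ> \<pi> \<circ> ?t) + E (g \<circ> \<pi>)) - (E (g \<circ> \<pi>) - scale (of_int (sign \<pi>)) (E g))"
      by (simp add: comp_assoc)
    ultimately show ?case
      by (simp only: qinv_lattice_diff swap.IH)
  qed
qed

text \<open>
  The exponents are shifted by \<open>\<rho>\<close>.
\<close>

text \<open>
  Let \<open>L\<close> be the linear map with \<open>L (x\<^sup>\<gamma>) = E \<gamma>\<close>, which is antisymmetric modulo the lattice. The left
  hand side of the identity between \<open>s\<close> and the alternants is the signed sum over all permutations \<open>\<pi>\<close>
  of \<open>s x\<^sup>\<pi>\<^sup>\<delta>\<close>, where each summand arises from \<open>s x\<^sup>\<delta>\<close> by permuting the variables, \<open>s\<close> being symmetric.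
  Thus \<open>L\<close> maps the left hand side to \<open>r! L (s x\<^sup>\<delta>)\<close>, and likewise the right hand side to \<open>r! L (x\<^sup>\<alpha>)\<close>.
\<close>

lemma antisymmetrization:
  fixes E :: "(nat \<Rightarrow> int) \<Rightarrow> 'n fock"
  assumes adj: "\<And>i g. Suc i < r \<Longrightarrow> E (g \<circ> Transposition.transpose i (Suc i)) + E g \<in> qinv_lattice r"
    and local: "\<And>g h. (\<And>i. i < r \<Longrightarrow> g i = h i) \<Longrightarrow> E g = E h"
    and s: "symmetric_in r s" "s * alternant r \<delta> = alternant r \<alpha>"
  shows "scale (of_int (fact r)) (\<Sum>\<beta>\<in>Poly_Mapping.keys s. scale (of_int (Poly_Mapping.lookup s \<beta>))
        (E (\<lambda>i. Poly_Mapping.lookup \<beta> i + \<delta> ! i)))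
      - scale (of_int (fact r)) (E (\<lambda>i. \<alpha> ! i)) \<in> qinv_lattice r"
proof -
  define L where "L = extend (\<lambda>\<gamma> c. scale (of_int c) (E (Poly_Mapping.lookup \<gamma>)))"
  have addL: "additive L"
    unfolding L_def by (rule additive_extend, rule additive.intro) (simp add: fock.scale_left_distrib)
  interpret L: additive L by (rule addL)
  have L_single: "L (Poly_Mapping.single \<gamma> c) = scale (of_int c) (E (Poly_Mapping.lookup \<gamma>))" for \<gamma> c
    unfolding L_def by (subst extend_single) simp_all
  have L_mult: "L (f * Poly_Mapping.single \<gamma> c) = (\<Sum>\<beta>\<in>Poly_Mapping.keys f.
      scale (of_int (c * Poly_Mapping.lookup f \<beta>)) (E (Poly_Mapping.lookup (\<beta> + \<gamma>))))" for f \<gamma> c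
  proof -
    have "L (f * Poly_Mapping.single \<gamma> c)
        = extend (\<lambda>\<beta> d. scale (of_int (c * d)) (E (Poly_Mapping.lookup (\<beta> + \<gamma>)))) f"
    proof (rule additive_eq_on_singles)
      show "additive (\<lambda>f. L (f * Poly_Mapping.single \<gamma> c))"
        by (rule additive.intro) (simp add: distrib_right L.add)
      show "additive (extend (\<lambda>\<beta> d. scale (of_int (c * d)) (E (Poly_Mapping.lookup (\<beta> + \<gamma>)))))"
        by (rule additive_extend, rule additive.intro) (simp add: distrib_left fock.scale_left_distrib)
      show "L (Poly_Mapping.single \<beta> d * Poly_Mapping.single \<gamma> c)
          = extend (\<lambda>\<beta> d. scale (of_int (c * d)) (E (Poly_Mapping.lookup (\<beta> + \<gamma>)))) (Poly_Mapping.single \<beta> d)" for \<beta> d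
        by (subst extend_single) (simp_all add: mult_single L_single mult.commute)
    qed
    then show ?thesis by (simp add: extend_def)
  qed
  let ?P = "{\<pi>. \<pi> permutes {..<r}}"
  note perm = adjacent_transpositions_suffice[of r E, OF adj]
  have card: "of_nat (card ?P) = (of_int (fact r) :: laurent)"
    by (subst card_permutations[of _ r]) simp_all
  have sign_sq: "sign \<pi> * sign \<pi> = 1" for \<pi> :: "nat \<Rightarrow> nat"
    by (simp add: sign_def)
  define x where "x = (\<Sum>\<beta>\<in>Poly_Mapping.keys s. scale (of_int (Poly_Mapping.lookup s \<beta>))
        (E (\<lambda>i. Poly_Mapping.lookup \<beta> i + \<delta> ! i)))"
  have "L (alternant r \<alpha>) - scale (of_int (fact r)) (E (\<lambda>i. \<alpha> ! i))
      = (\<Sum>\<pi>\<in>?P. scale (of_int (sign \<pi>)) (E ((\<lambda>i. \<alpha> ! i) \<circ> \<pi>) - scale (of_int (sign \<pi>)) (E (\<lambda>i. \<alpha> ! i))))"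
  proof -
    have "E (Poly_Mapping.lookup (exponent r \<alpha> \<pi>)) = E ((\<lambda>i. \<alpha> ! i) \<circ> \<pi>)" for \<pi>
      by (rule local) (simp add: lookup_exponent)
    then have "L (alternant r \<alpha>) = (\<Sum>\<pi>\<in>?P. scale (of_int (sign \<pi>)) (E ((\<lambda>i. \<alpha> ! i) \<circ> \<pi>)))"
      by (simp add: alternant_eq_exponents L.sum L_single)
    moreover have "scale (of_int (fact r)) (E (\<lambda>i. \<alpha> ! i)) = (\<Sum>\<pi>\<in>?P. E (\<lambda>i. \<alpha> ! i))"
      by (simp only: fock.sum_constant_scale card)
    ultimately show ?thesis
      by (simp add: fock.scale_right_diff_distrib sum_subtractf sign_sq flip: of_int_mult)
  qed
  also have "\<dots> \<in> qinv_lattice r"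
    by (intro qinv_lattice_sum qinv_lattice_scale perm) auto
  finally have rhs: "L (alternant r \<alpha>) - scale (of_int (fact r)) (E (\<lambda>i. \<alpha> ! i)) \<in> qinv_lattice r" .
  have "L (s * alternant r \<delta>) - scale (of_int (fact r)) x
      = (\<Sum>\<pi>\<in>?P. \<Sum>\<beta>\<in>Poly_Mapping.keys s. scale (of_int (sign \<pi> * Poly_Mapping.lookup s \<beta>))
          (E ((\<lambda>i. Poly_Mapping.lookup \<beta> i + \<delta> ! i) \<circ> \<pi>)
            - scale (of_int (sign \<pi>)) (E (\<lambda>i. Poly_Mapping.lookup \<beta> i + \<delta> ! i))))"
  proof -
    have "L (s * Poly_Mapping.single (exponent r \<delta> \<pi>) (sign \<pi>))
        = (\<Sum>\<beta>\<in>Poly_Mapping.keys s. scale (of_int (sign \<pi> * Poly_Mapping.lookup s \<beta>))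
          (E ((\<lambda>i. Poly_Mapping.lookup \<beta> i + \<delta> ! i) \<circ> \<pi>)))" if \<pi>: "\<pi> permutes {..<r}" for \<pi>
    proof -
      have "E (Poly_Mapping.lookup (permute_exponent \<pi> \<beta> + exponent r \<delta> \<pi>))
          = E ((\<lambda>i. Poly_Mapping.lookup \<beta> i + \<delta> ! i) \<circ> \<pi>)" for \<beta>
        by (rule local) (simp add: lookup_add lookup_exponent lookup_permute_exponent[OF permutes_inj[OF \<pi>]])
      moreover have "Poly_Mapping.lookup s (permute_exponent \<pi> \<beta>) = Poly_Mapping.lookup s \<beta>" for \<beta>
        using s(1) \<pi> by (simp add: symmetric_in_def)
      ultimately show ?thesis
        unfolding L_mult by (subst sum_keys_symmetric[OF s(1) \<pi>, symmetric]) simp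
    qed
    then have "L (s * alternant r \<delta>) = (\<Sum>\<pi>\<in>?P. \<Sum>\<beta>\<in>Poly_Mapping.keys s.
        scale (of_int (sign \<pi> * Poly_Mapping.lookup s \<beta>)) (E ((\<lambda>i. Poly_Mapping.lookup \<beta> i + \<delta> ! i) \<circ> \<pi>)))"
      by (simp add: alternant_eq_exponents sum_distrib_left L.sum)
    moreover have "scale (of_int (fact r)) x = (\<Sum>\<pi>\<in>?P. x)"
      by (simp only: fock.sum_constant_scale card)
    moreover have "scale (of_int (sign \<pi> * c)) (scale (of_int (sign \<pi>)) y) = scale (of_int c) y"
      for \<pi> :: "nat \<Rightarrow> nat" and c and y :: "'n fock"
      using sign_sq[of \<pi>] by (simp add: mult.commute mult.left_commute flip: of_int_mult)
    ultimately show ?thesis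
      by (simp add: fock.scale_right_diff_distrib sum_subtractf x_def del: of_int_mult fock.scale_scale)
  qed
  also have "\<dots> \<in> qinv_lattice r"
    by (intro qinv_lattice_sum qinv_lattice_scale perm) (auto simp del: of_int_mult)
  finally have lhs: "L (s * alternant r \<delta>) - scale (of_int (fact r)) x \<in> qinv_lattice r" .
  show ?thesis
    using qinv_lattice_diff[OF rhs lhs] by (simp add: s(2) x_def)
qed

text \<open>
  The entries of \<open>\<rho>\<close> at adjacent positions differ by 1, so that the two letters are \<open>\<mu>\<^sub>i - n\<close> and
  \<open>\<mu>\<^sub>i\<^sub>+\<^sub>1\<close>, shifted by multiples of \<open>n\<close> which the transposition exchanges. For a gap below \<open>n\<close> these
  letters differ by less than \<open>n\<close>, and the symmetrized relation applies; for the gap \<open>n\<close> they are equal,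
  and congruent letters anticommute.
\<close>

lemma ket_adjacent_antisymmetric:
  assumes n: "0 < CARD('n)" and \<mu>: "length \<mu> = r" and i: "Suc i < r"
    and gap: "1 \<le> \<mu> ! i - \<mu> ! Suc i" "\<mu> ! i - \<mu> ! Suc i \<le> int CARD('n)"
  shows "(ket (shift CARD('n) (\<lambda>k. (g \<circ> Transposition.transpose i (Suc i)) k - rho r ! k) \<mu>) :: 'n fock)
    + ket (shift CARD('n) (\<lambda>k. g k - rho r ! k) \<mu>) \<in> qinv_lattice r"
proof -
  let ?n = "int CARD('n)" and ?t = "Transposition.transpose i (Suc i)"
  define xs a b ys where "xs = take i \<mu>" and "a = \<mu> ! i" and "b = \<mu> ! Suc i" and "ys = drop (Suc (Suc i)) \<mu>"
  have \<mu>_eq: "\<mu> = xs @ [a, b] @ ys" and len: "length xs = i" "i + 2 + length ys = r"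
    using \<mu> i by (auto simp: xs_def a_def b_def ys_def Cons_nth_drop_Suc)
  define X where "X = shift CARD('n) (\<lambda>k. g k - rho r ! k) xs"
  define Y where "Y = shift CARD('n) (\<lambda>k. g (k + length xs + 2) - rho r ! (k + length xs + 2)) ys"
  define m where "m = g i - rho r ! Suc i"
  define m' where "m' = g (Suc i) - rho r ! Suc i"
  have rho: "rho r ! i = rho r ! Suc i + 1"
    using i by (simp add: nth_rho of_nat_diff)
  have 1: "shift CARD('n) (\<lambda>k. g k - rho r ! k) \<mu> = X @ [a - ?n + ?n * m, b + ?n * m'] @ Y"
    unfolding \<mu>_eq shift_split by (simp add: X_def Y_def m_def m'_def len rho algebra_simps)
  have X': "shift CARD('n) (\<lambda>k. (g \<circ> ?t) k - rho r ! k) xs = X"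
    unfolding X_def by (rule shift_cong) (simp add: len transpose_apply_other)
  have 2: "shift CARD('n) (\<lambda>k. (g \<circ> ?t) k - rho r ! k) \<mu> = X @ [a - ?n + ?n * m', b + ?n * m] @ Y"
    unfolding \<mu>_eq shift_split X'
    by (simp add: Y_def m_def m'_def len rho algebra_simps transpose_apply_other)
  have lenXY: "length X + 2 + length Y = r"
    using len by (simp add: X_def Y_def)
  show ?thesis
  proof (cases "a - b = ?n")
    case True
    have "(ket (X @ [a - ?n + ?n * m', b + ?n * m] @ Y) :: 'n fock)
        = - ket (X @ [b + ?n * m, a - ?n + ?n * m'] @ Y)"
      by (rule ket_congruent) (use True in \<open>simp add: algebra_simps flip: right_diff_distrib\<close>)
    then show ?thesis
      unfolding 1 2 using True by (simp add: qinv_lattice_0 algebra_simps)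
  next
    case False
    then have lt: "a - ?n < b" "b < a - ?n + ?n"
      using gap by (simp_all add: a_def b_def)
    have "(ket (X @ [u, v] @ Y) :: 'n fock) \<in> lattice_minus r" for u v
      by (rule ket_in_lattice[OF n]) (use lenXY in simp)
    then show ?thesis
      unfolding 1 2 ket_symmetrized[OF lt]
      by (intro qinv_lattice_uminus qinv_latticeI lattice_minus_add)
  qed
qed

lemma center_act_lattice_minus:
  assumes n: "0 < CARD('n)" and f: "symmetric_in r f" and x: "(x :: 'n fock) \<in> lattice_minus r"
  shows "center_act r f x \<in> lattice_minus r"
proof -
  obtain A c where A: "x = (\<Sum>\<mu>\<in>A. scale (c \<mu>) (ket \<mu>))" "A \<subseteq> strict_weights r"
    "\<And>\<mu>. \<mu> \<in> A \<Longrightarrow> c \<mu> \<in> poly_in_qinv"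
    using lattice_minusE[OF x] by metis
  have len: "length \<mu> = r" if "\<mu> \<in> A" for \<mu>
    using that A(2) strict_weights_length by blast
  have "center_act r f x = (\<Sum>\<mu>\<in>A. scale (c \<mu>) (\<Sum>\<beta>\<in>Poly_Mapping.keys f.
      scale (of_int (Poly_Mapping.lookup f \<beta>)) (ket (shift CARD('n) (\<lambda>i. - Poly_Mapping.lookup \<beta> i) \<mu>))))"
    unfolding A(1) additive.sum[OF additive_center_act[OF f]] center_act_scale[OF f]
    by (intro sum.cong) (simp_all add: center_act_ket[OF f] len)
  also have "\<dots> \<in> lattice_minus r"
    using A(3) by (intro lattice_minus_sum lattice_minus_scale ket_in_lattice[OF n]) (simp_all add: len)
  finally show ?thesis .
qed

lemma center_act_qinv_lattice:
  assumes n: "0 < CARD('n)" and f: "symmetric_in r f" and x: "(x :: 'n fock) \<in> qinv_lattice r"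
  shows "center_act r f x \<in> qinv_lattice r"
  using x center_act_lattice_minus[OF n f] by (auto simp: center_act_scale[OF f])

lemma S_op_ket:
  assumes f: "symmetric_in r (schur r \<kappa>)" and \<mu>: "length \<mu> = r"
  shows "(S_op r \<kappa> (ket \<mu>) :: 'n fock) = (\<Sum>\<beta>\<in>Poly_Mapping.keys (schur r \<kappa>).
      scale (of_int (Poly_Mapping.lookup (schur r \<kappa>) \<beta>)) (ket (shift CARD('n) (Poly_Mapping.lookup \<beta>) \<mu>)))"
proof -
  have k: "Poly_Mapping.keys (invert_vars (schur r \<kappa>)) = uminus ` Poly_Mapping.keys (schur r \<kappa>)"
    by (auto simp: in_keys_iff lookup_invert_vars image_iff intro: exI[of _ "- _"])
      (metis in_keys_iff minus_minus)
  show ?thesis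
    unfolding S_op_def center_act_ket[OF symmetric_invert_vars[OF f] \<mu>] k
    by (subst sum.reindex) (auto simp: inj_on_def lookup_invert_vars)
qed

theorem theorem6p9:
  fixes r :: nat
    and G :: "int list \<Rightarrow> 'n fock"
    and lam lam0 lam1 :: "int list"
  assumes n: "2 \<le> CARD('n)"
    and r: "2 \<le> r"
    and G: "is_canonical_basis r G"
    and len: "length lam = r" "length lam0 = r" "length lam1 = r"
    and dominant: "sorted_wrt (\<ge>) lam"
    and decomp: "lam = weight_add lam0 (weight_scale (int CARD('n)) lam1)"
    and restricted: "\<And>i. i < r - 1 \<Longrightarrow>
      0 \<le> lam0 ! i - lam0 ! (i + 1) \<and> lam0 ! i - lam0 ! (i + 1) < int CARD('n)"
    and nonneg: "0 \<le> lam1 ! (r - 1)"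
  shows "G (weight_add lam (rho r)) = S_op r lam1 (G (weight_add lam0 (rho r)))"
proof -
  let ?n = "int CARD('n)"
  have r0: "0 < r" and n0: "0 < CARD('n)" using r n by simp_all
  have lam_nth: "lam ! i = lam0 ! i + ?n * lam1 ! i" if "i < r" for i
    using that len unfolding decomp by (simp add: weight_add_def weight_scale_def)
  have gap: "lam1 ! Suc i \<le> lam1 ! i" if i: "Suc i < r" for i
  proof (rule ccontr)
    assume "\<not> lam1 ! Suc i \<le> lam1 ! i"
    then have "?n * (lam1 ! i + 1) \<le> ?n * lam1 ! Suc i" by (intro mult_left_mono) simp_all
    moreover have "lam ! Suc i \<le> lam ! i"
      using dominant i len(1) by (simp add: sorted_wrt_iff_nth_less)
    moreover have "i < r - 1" using i by simp
    ultimately show False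
      using restricted[of i] i lam_nth[of i] lam_nth[of "Suc i"] by (simp add: distrib_left)
  qed
  have nonneg_all: "0 \<le> lam1 ! j" if "j < r" for j
  proof -
    have "j \<le> r - 1" using that by simp
    then show ?thesis
    proof (induction rule: inc_induct)
      case (step j)
      then have "Suc j < r" by simp
      with step.IH gap[of j] show ?case by simp
    qed (rule nonneg)
  qed
  define \<mu>0 where "\<mu>0 = weight_add lam0 (rho r)"
  define \<mu> where "\<mu> = weight_add lam (rho r)"
  have len\<mu>: "length \<mu>0 = r" "length \<mu> = r"
    by (simp_all add: \<mu>0_def \<mu>_def weight_add_def len)
  have \<mu>0_nth: "\<mu>0 ! i = lam0 ! i + rho r ! i" and \<mu>_nth: "\<mu> ! i = lam ! i + rho r ! i" if "i < r" for i
    using that len by (simp_all add: \<mu>0_def \<mu>_def weight_add_def)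
  have gap0: "1 \<le> \<mu>0 ! i - \<mu>0 ! Suc i" "\<mu>0 ! i - \<mu>0 ! Suc i \<le> ?n" if "Suc i < r" for i
  proof -
    have "i < r - 1" using that by simp
    from restricted[OF this] show "1 \<le> \<mu>0 ! i - \<mu>0 ! Suc i" "\<mu>0 ! i - \<mu>0 ! Suc i \<le> ?n"
      using that by (simp_all add: \<mu>0_nth nth_rho of_nat_diff)
  qed
  have strict0: "\<mu>0 \<in> strict_weights r"
    using gap0 len\<mu> by (force simp: strict_weights_def sorted_wrt_iff_nth_Suc_transp[OF transp_on_greater])
  have strict: "\<mu> \<in> strict_weights r"
    using dominant len\<mu> len
    by (force simp: strict_weights_def sorted_wrt_iff_nth_less \<mu>_nth nth_rho of_nat_diff)
  let ?s = "schur r lam1"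
  have s: "symmetric_in r ?s" "?s * alternant r (rho r) = alternant r (weight_add lam1 (rho r))"
    by (intro symmetric_schur schur_mult_alternant r0 len nonneg_all; assumption)+
  note sym = symmetric_invert_vars[OF s(1)]
  define E where "E g = (ket (shift CARD('n) (\<lambda>k. g k - rho r ! k) \<mu>0) :: 'n fock)" for g
  let ?F = "of_int (fact r) :: laurent"
  have "scale ?F (\<Sum>\<beta>\<in>Poly_Mapping.keys ?s. scale (of_int (Poly_Mapping.lookup ?s \<beta>))
        (E (\<lambda>i. Poly_Mapping.lookup \<beta> i + rho r ! i)))
      - scale ?F (E (\<lambda>i. weight_add lam1 (rho r) ! i)) \<in> qinv_lattice r"
  proof (rule antisymmetrization[OF _ _ s])
    show "E (g \<circ> Transposition.transpose i (Suc i)) + E g \<in> qinv_lattice r" if "Suc i < r" for i g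
      unfolding E_def by (rule ket_adjacent_antisymmetric[OF n0 len\<mu>(1) that gap0[OF that]])
    show "E g = E h" if "\<And>i. i < r \<Longrightarrow> g i = h i" for g h
      unfolding E_def by (intro arg_cong[where f = ket] shift_cong) (simp add: that len\<mu>)
  qed
  moreover have "E (\<lambda>i. weight_add lam1 (rho r) ! i) = ket \<mu>"
    unfolding E_def
    by (intro arg_cong[where f = ket] nth_equalityI)
      (simp_all add: len\<mu> nth_shift \<mu>0_nth \<mu>_nth lam_nth len weight_add_def)
  ultimately have key: "scale ?F (S_op r lam1 (ket \<mu>0)) - scale ?F (ket \<mu> :: 'n fock) \<in> qinv_lattice r"
    unfolding E_def by (simp add: S_op_ket[OF s(1) len\<mu>(1)])
  have Gket: "G \<nu> - ket \<nu> \<in> qinv_lattice r" and Gbar: "bar (G \<nu>) = G \<nu>" if "\<nu> \<in> strict_weights r" for \<nu>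
    using G that by (auto simp: is_canonical_basis_def)
  have Glat: "G \<nu> \<in> lattice_minus r" if "\<nu> \<in> strict_weights r" for \<nu>
  proof -
    have "qinv_lattice r \<subseteq> (lattice_minus r :: 'n fock set)"
      by (auto intro!: lattice_minus_scale poly_in_qinv_qpow)
    then have "(G \<nu> - ket \<nu>) + ket \<nu> \<in> lattice_minus r"
      using Gket[OF that] that by (intro lattice_minus_add lattice_minus_strict_ket) auto
    then show ?thesis by simp
  qed
  interpret S: additive "S_op r lam1 :: 'n fock \<Rightarrow> 'n fock"
    unfolding S_op_def by (rule additive_center_act[OF sym])
  define x where "x = G \<mu> - S_op r lam1 (G \<mu>0)"
  \<comment> \<open>The factor \<open>r!\<close> is kept until the end, where it is cancelled by freeness.\<close>
  have "scale ?F x = scale ?F (G \<mu> - ket \<mu>) - scale ?F (S_op r lam1 (G \<mu>0 - ket \<mu>0))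
      - (scale ?F (S_op r lam1 (ket \<mu>0)) - scale ?F (ket \<mu>))"
    by (simp add: x_def S.diff fock.scale_right_diff_distrib)
  also have "\<dots> \<in> qinv_lattice r"
    unfolding S_op_def
    by (intro qinv_lattice_diff[OF _ key[unfolded S_op_def]] qinv_lattice_diff[where y = "scale _ (center_act _ _ _)"]
        qinv_lattice_scale poly_in_qinv_of_int center_act_qinv_lattice[OF n0 sym] Gket strict strict0)
  finally have "scale ?F x \<in> qinv_lattice r" .
  moreover have "bar x = x"
    by (simp add: x_def bar.diff Gbar strict strict0 S_op_def bar_center_act[OF sym])
  then have "bar (scale ?F x) = scale ?F x"
    by (simp only: bar_scale laurent_conj_of_int)
  ultimately have "scale ?F x = 0"
    by (rule bar_invariant_in_qinv_lattice[OF G])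
  moreover have "x \<in> fock_space r"
  proof -
    have "x \<in> lattice_minus r"
      unfolding x_def S_op_def
      by (intro lattice_minus_diff center_act_lattice_minus[OF n0 sym] Glat strict strict0)
    then show ?thesis using lattice_minus_subset_fock_space by blast
  qed
  moreover have "?F \<noteq> 0" by simp
  ultimately have "x = 0"
    using canonical_basis_torsion_free[OF G] by blast
  then show ?thesis by (simp add: x_def \<mu>_def \<mu>0_def)
qed

end
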